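(* Let $G$ be a graph with degree sequence $d=(d_1,\dots,d_n)$ and vertex set $\{v_1,\dots,v_n\}$, indexed so that $d_G(v_i)=d_i$. Suppose that $(G_\ell,A_\ell,B_\ell) \circ \dots \circ (G_1,A_1,B_1) \circ G_0$ is the canonical decomposition of $G$, where $A_0$ and $B_0$ partition $V(G_0)$ into an independent set and a clique, respectively, if $G_0$ is split. (a) A nonempty set $W \subseteq V(G)$ is equal to the clique $B_j$ in the canonical component $(G_j,A_j,B_j)$ if and only if $W=\{v_i : k<i \leq k'\}$ for a pair $k,k'$ of consecutive terms in $EG(d)$. In this case the corresponding independent set $A_j$ is precisely the set $\{v \in V(G): k<d_G(v)<k'\}$. (b) Given a term $k$ of $EG(d)$, if $i>k$ and $d_G(v_i)=k$, then the canonical component containing $v_i$ is trivial. (c) If $k$ is a positive term of $EG(d)$ and $(G_j,A_j,B_j)$ is the splitted canonical component containing $v_k$, then \[d^*_k=\left|V(G_0) \cup \bigcup_{i=1}^\ell B_i \cup \bigcup_{i=1}^{j-1} A_i\right|.\] (d) Let $(G_j,A_j,B_j)$ be a splitted canonical component, and let $k$ and $k'$ be the consecutive terms of $EG(d)$ such that $B_j = \{v_i:k<i\leq k'\}$. If $v \in B_j$, then $d_G(v) = d_{G_j}(v)-k'+k+d^*_{k'}$. If $v \in A_j$, then $d_G(v) =d_{G_j}(v)+k$.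
   Context: All graphs have no loops or multiple edges. Degree sequences are listed in descending order; $V(H)$ is the vertex set of a graph $H$, and $d_H(v)$ is the degree of $v$ in $H$. For a degree sequence $d=(d_1,\dots,d_n)$ in descending order and a nonnegative integer $k\le n$, the $k$th Erdős–Gallai inequality is $\sum_{i=1}^k d_i \leq k(k-1) + \sum_{i=k+1}^n \min\{k,d_i\}$, where a sum whose starting index exceeds its ending index has value $0$. $EG(d)$ denotes the list, ordered from smallest to largest, of the nonnegative integers $k$ for which the $k$th Erdős–Gallai inequality holds with equality; it always begins with $0$. For $j\ge 0$, $d^*_j=\max\{i: d_i\ge j\}$, that is, the number of terms of $d$ having value at least $j$. A graph is split if its vertex set can be partitioned into an independent set and a clique. A splitted graph is a triple $(G,A,B)$ where $G$ is a split graph and $A,B$ is a partition of $V(G)$ into an independent set $A$ and a clique $B$. Two splitted graphs $(G,A,B)$ and $(G',A',B')$ are isomorphic if there is a graph isomorphism $\varphi:V(G)\to V(G')$ with $\varphi(A)=A'$. For a splitted graph $(G,A,B)$ and a graph $H$ on disjoint vertex sets, the composition $(G,A,B)\circ H$ is the graph formed by adding to the disjoint union $G+H$ all edges $uv$ such that $u\in B$ and $v\in V(H)$. The composition of two splitted graphs may also be regarded as a splitted graph, whose independent set and clique are the unions of the independent sets and of the cliques, respectively; the operation $\circ$ is associative. A graph is decomposable if it can be written as a composition $(G,A,B)\circ H$ where $G$ and $H$ both have at least one vertex; otherwise it is indecomposable. By a theorem of Tyshkevich, every graph $G$ can be expressed as a composition $G=(G_\ell,A_\ell,B_\ell)\circ\dots\circ(G_1,A_1,B_1)\circ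 G_0$, where the $(G_i,A_i,B_i)$ are indecomposable splitted graphs and $G_0$ is an indecomposable graph ($\ell=0$ if $G$ is indecomposable), and this expression is unique up to isomorphism of the components. It is called the canonical decomposition of $G$, and the indecomposable graphs in it are the canonical components of $G$. A canonical component is nontrivial if it has more than one vertex, and trivial otherwise.
   Formalization: If G_0 is one vertex, take B_0=V(G_0) and, among equal degrees, index it after vertices of B_i and before those of A_i (i≥1); (c) is for j≥1; (d) omits j=0 when G_0 is one vertex. Otherwise false: K_1 for (a) and (d), K_2 with G_0 listed first for (c), P_4 for (c) with j=0. *)

theory Defs
  imports Main
begin

record 'a graph =
  verts :: "'a set"
  edges :: "'a set set"

definition simple_graph :: "'a graph \<Rightarrow> bool" where
  "simple_graph G \<longleftrightarrow>
     finite (verts G) \<and>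
     (\<forall>e\<in>edges G. \<exists>u\<in>verts G. \<exists>v\<in>verts G. u \<noteq> v \<and> e = {u, v})"

definition degree :: "'a graph \<Rightarrow> 'a \<Rightarrow> nat" where
  "degree G v = card {u. {u, v} \<in> edges G}"

definition independent_set :: "'a graph \<Rightarrow> 'a set \<Rightarrow> bool" where
  "independent_set G S \<longleftrightarrow>
     S \<subseteq> verts G \<and> (\<forall>u\<in>S. \<forall>v\<in>S. {u, v} \<notin> edges G)"

definition clique :: "'a graph \<Rightarrow> 'a set \<Rightarrow> bool" where
  "clique G S \<longleftrightarrow>
     S \<subseteq> verts G \<and> (\<forall>u\<in>S. \<forall>v\<in>S. u \<noteq> v \<longrightarrow> {u, v} \<in> edges G)"

text \<open>One of the two classes of a partition into an independent set and a clique may be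
  empty; a one-vertex graph therefore carries two different splitted structures.\<close>

definition splitted_graph :: "'a graph \<Rightarrow> 'a set \<Rightarrow> 'a set \<Rightarrow> bool" where
  "splitted_graph G A B \<longleftrightarrow>
     simple_graph G \<and> A \<union> B = verts G \<and> A \<inter> B = {} \<and>
     independent_set G A \<and> clique G B"

definition split_graph :: "'a graph \<Rightarrow> bool" where
  "split_graph G \<longleftrightarrow> (\<exists>A B. splitted_graph G A B)"

text \<open>The composition of the splitted graph \<open>(G, A, B)\<close> with \<open>H\<close> depends on \<open>A\<close> only through
  \<open>verts G\<close>, so \<open>A\<close> is not an argument.  It is meaningful only for disjoint vertex sets.\<close>

definition compose :: "'a graph \<Rightarrow> 'a set \<Rightarrow> 'a graph \<Rightarrow> 'a graph" where
  "compose G B H =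
     \<lparr> verts = verts G \<union> verts H,
       edges = edges G \<union> edges H \<union> {{u, v} | u v. u \<in> B \<and> v \<in> verts H} \<rparr>"

definition decomposable :: "'a graph \<Rightarrow> bool" where
  "decomposable G \<longleftrightarrow>
     (\<exists>G' A' B' H. splitted_graph G' A' B' \<and> simple_graph H \<and>
        verts G' \<inter> verts H = {} \<and> verts G' \<noteq> {} \<and> verts H \<noteq> {} \<and>
        G = compose G' B' H)"

definition trivial_graph :: "'a graph \<Rightarrow> bool" where
  "trivial_graph G \<longleftrightarrow> card (verts G) = 1"

text \<open>\<open>composition C B m\<close> is \<open>(C m, A m, B m) \<circ> \<dots> \<circ> (C 1, A 1, B 1) \<circ> C 0\<close>.\<close>

primrec composition :: "(nat \<Rightarrow> 'a graph) \<Rightarrow> (nat \<Rightarrow> 'a set) \<Rightarrow> nat \<Rightarrow> 'a graph" where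
  "composition C B 0 = C 0"
| "composition C B (Suc m) = compose (C (Suc m)) (B (Suc m)) (composition C B m)"

text \<open>Components are required to be nonempty: the graph without vertices would otherwise count
  as an indecomposable component that can be inserted anywhere.  The values \<open>A 0\<close> and \<open>B 0\<close>
  are unconstrained here.\<close>

definition canonical_decomposition ::
  "'a graph \<Rightarrow> nat \<Rightarrow> (nat \<Rightarrow> 'a graph) \<Rightarrow> (nat \<Rightarrow> 'a set) \<Rightarrow> (nat \<Rightarrow> 'a set) \<Rightarrow> bool" where
  "canonical_decomposition G l C A B \<longleftrightarrow>
     (\<forall>i\<in>{0..l}. simple_graph (C i) \<and> verts (C i) \<noteq> {} \<and> \<not> decomposable (C i)) \<and>
     (\<forall>i\<in>{1..l}. splitted_graph (C i) (A i) (B i)) \<and>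
     (\<forall>i\<in>{0..l}. \<forall>j\<in>{0..l}. i \<noteq> j \<longrightarrow> verts (C i) \<inter> verts (C j) = {}) \<and>
     G = composition C B l"

text \<open>A sequence \<open>(d\<^sub>1, \<dots>, d\<^sub>n)\<close> is represented by its length \<open>n\<close> and a function of which only
  the values on \<open>{1..n}\<close> matter.  The truncated \<open>k - 1\<close> is harmless, as \<open>k * (k - 1)\<close> is \<open>0\<close> for
  \<open>k = 0\<close> in any case.\<close>

definition EG_equality :: "nat \<Rightarrow> (nat \<Rightarrow> nat) \<Rightarrow> nat \<Rightarrow> bool" where
  "EG_equality n d k \<longleftrightarrow>
     (\<Sum>i=1..k. d i) = k * (k - 1) + (\<Sum>i=k+1..n. min k (d i))"

definition EG :: "nat \<Rightarrow> (nat \<Rightarrow> nat) \<Rightarrow> nat list" where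
  "EG n d = filter (EG_equality n d) [0..<n+1]"

definition consecutive_terms :: "'b list \<Rightarrow> 'b \<Rightarrow> 'b \<Rightarrow> bool" where
  "consecutive_terms xs x y \<longleftrightarrow> (\<exists>us vs. xs = us @ [x, y] @ vs)"

definition dstar :: "nat \<Rightarrow> (nat \<Rightarrow> nat) \<Rightarrow> nat \<Rightarrow> nat" where
  "dstar n d j = card {i\<in>{1..n}. j \<le> d i}"

text \<open>Equal degrees leave the indexing \<open>v\<close> of the vertices undetermined.  This matters only if
  the last component \<open>C 0\<close> has a single vertex, which may then have the same degree as one-vertex
  components next to it (for instance in a complete or an edgeless graph).  The convention is
  that, among vertices of equal degree, the vertex of such a \<open>C 0\<close> is listed after those in the
  cliques \<open>B 1, \<dots>, B l\<close> and before those in the independent sets \<open>A 1, \<dots>, A l\<close>.  Every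
  descending order of the degrees can be realised by such an indexing.\<close>

definition ties_respect_core ::
  "nat \<Rightarrow> (nat \<Rightarrow> nat) \<Rightarrow> (nat \<Rightarrow> 'a) \<Rightarrow> nat \<Rightarrow> (nat \<Rightarrow> 'a graph) \<Rightarrow> (nat \<Rightarrow> 'a set)
     \<Rightarrow> (nat \<Rightarrow> 'a set) \<Rightarrow> bool" where
  "ties_respect_core n d v l C A B \<longleftrightarrow>
     (trivial_graph (C 0) \<longrightarrow>
       (\<forall>p\<in>{1..n}. \<forall>q\<in>{1..n}. v p \<in> verts (C 0) \<and> d q = d p \<longrightarrow>
          (v q \<in> (\<Union>j\<in>{1..l}. B j) \<longrightarrow> q < p) \<and>
          (v q \<in> (\<Union>j\<in>{1..l}. A j) \<longrightarrow> p < q)))"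

end

theory Submission
  imports Defs
begin

text \<open>Counting edges between a set of top-degree vertices and the rest shows that the \<open>k\<close>th
  inequality is an equality iff the first \<open>k\<close> vertices form a clique such that every other
  vertex is adjacent to all of it or has all its neighbours in it, i.e. iff they are the clique of
  a splitted factor in a composition of the graph.  Indecomposability makes such a clique meet each
  nontrivial component in nothing or in its clique part, so the equality indices are the sizes of
  the unions \<open>U m\<close> of the cliques \<open>B m, \<dots>, B l\<close>.  These unions are separated from
  the other vertices by a strict drop in degree next to every component whose independent set is
  nonempty; the only ties left are in runs of one-vertex cliques, where the order does not matter.\<close>

subsection \<open>Neighbourhoods\<close>

text \<open>Ties are the obstacle: \<open>U m\<close> consists of vertices of largest degree, yet it
  need not be an initial segment of the given listing. Two facts get around this. Both sides of an
  inequality depend on degrees only, so equality at \<open>k\<close> can be tested on any set of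
  \<open>k\<close> vertices of largest degree. And where an equality index jumps by at least two,
  the level responsible is nontrivial, its boundaries are strict drops, and the initial segments
  there are forced to be \<open>U (Suc m)\<close> and \<open>U m\<close>. Where the index grows by
  one, the new vertex may belong to another level than the one whose size produced the index; it is
  only shown that its own component is trivial, which suffices.

  A one-vertex core admits two splitted structures and is counted as a clique. In a nonempty
  edgeless graph 0 and 1 are both equality indices, so the step between them must come from some
  clique. With this choice a one-vertex component with nonempty independent set always has the core
  inside it, and the core vertex serves as the missing nonneighbour in degree comparisons.\<close>

definition nbrs :: "'a graph \<Rightarrow> 'a \<Rightarrow> 'a set" where
  "nbrs G x = {u. {u, x} \<in> edges G}"

lemma degree_nbrs: "degree G x = card (nbrs G x)"
  by (simp add: degree_def nbrs_def)

lemma nbrs_sym: "u \<in> nbrs G x \<longleftrightarrow> x \<in> nbrs G u"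
  by (simp add: nbrs_def insert_commute)

lemma nbrs_verts:
  assumes "simple_graph G" "u \<in> nbrs G x"
  shows "u \<in> verts G \<and> x \<in> verts G \<and> u \<noteq> x"
proof -
  obtain a b where "a \<in> verts G" "b \<in> verts G" "a \<noteq> b" "{u, x} = {a, b}"
    using assms unfolding simple_graph_def nbrs_def by (metis mem_Collect_eq)
  then show ?thesis
    by (auto simp: doubleton_eq_iff)
qed

lemma nbrs_irrefl: "simple_graph G \<Longrightarrow> x \<notin> nbrs G x"
  using nbrs_verts[of G x x] by blast

lemma nbrs_subset: "simple_graph G \<Longrightarrow> nbrs G x \<subseteq> verts G"
  by (rule subsetI) (simp add: nbrs_verts)

lemma finite_verts: "simple_graph G \<Longrightarrow> finite (verts G)"
  by (simp add: simple_graph_def)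

lemma finite_nbrs: "simple_graph G \<Longrightarrow> finite (nbrs G x)"
  by (rule finite_subset[OF nbrs_subset finite_verts])

lemma clique_nbrs: "clique G S \<longleftrightarrow> S \<subseteq> verts G \<and> (\<forall>u\<in>S. \<forall>x\<in>S. u \<noteq> x \<longrightarrow> u \<in> nbrs G x)"
  by (auto simp: clique_def nbrs_def)

lemma independent_nbrs:
  "independent_set G S \<longleftrightarrow> S \<subseteq> verts G \<and> (\<forall>u\<in>S. \<forall>x\<in>S. u \<notin> nbrs G x)"
  by (auto simp: independent_set_def nbrs_def)

text \<open>Exempting \<open>x\<close> from the inclusion allows \<open>x\<close> and
  \<open>y\<close> to be adjacent: deleting each from the other's neighbourhood then costs both
  sides one element.\<close>

lemma degree_mono:
  assumes "simple_graph G" "nbrs G y - {x} \<subseteq> nbrs G x"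
  shows "degree G y \<le> degree G x"
proof (cases "x \<in> nbrs G y")
  case True
  then have y: "y \<in> nbrs G x" by (simp add: nbrs_sym)
  have "nbrs G y - {x} \<subseteq> nbrs G x - {y}"
    using assms(2) nbrs_irrefl[OF assms(1), of y] by auto
  then have "card (nbrs G y - {x}) \<le> card (nbrs G x - {y})"
    using finite_nbrs[OF assms(1)] by (simp add: card_mono)
  moreover have "card (nbrs G y) > 0" "card (nbrs G x) > 0"
    using True y finite_nbrs[OF assms(1)] by (auto simp: card_gt_0_iff)
  ultimately show ?thesis
    using True y by (simp add: degree_nbrs card_Diff_singleton)
next
  case False
  then show ?thesis
    using assms finite_nbrs[OF assms(1)] by (simp add: degree_nbrs card_mono)
qed

text \<open>The condition \<open>z \<noteq> y\<close> matters when \<open>x\<close> and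
  \<open>y\<close> are adjacent: then \<open>y\<close> itself lies in \<open>nbrs G x\<close> but
  not in \<open>nbrs G y\<close>, even if the degrees agree.\<close>

lemma degree_strict_mono:
  assumes "simple_graph G" "nbrs G y - {x} \<subseteq> nbrs G x"
    and "z \<in> nbrs G x" "z \<notin> nbrs G y" "z \<noteq> y"
  shows "degree G y < degree G x"
proof (cases "x \<in> nbrs G y")
  case True
  then have y: "y \<in> nbrs G x" by (simp add: nbrs_sym)
  have "nbrs G y - {x} \<subseteq> nbrs G x - {y}" "z \<in> nbrs G x - {y}" "z \<notin> nbrs G y - {x}"
    using assms(2-5) nbrs_irrefl[OF assms(1), of y] by auto
  then have "nbrs G y - {x} \<subset> nbrs G x - {y}"
    by blast
  then have "card (nbrs G y - {x}) < card (nbrs G x - {y})"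
    using finite_nbrs[OF assms(1)] by (simp add: psubset_card_mono)
  then show ?thesis
    using True y by (simp add: degree_nbrs card_Diff_singleton)
next
  case False
  then have "nbrs G y \<subseteq> nbrs G x" "z \<in> nbrs G x" "z \<notin> nbrs G y"
    using assms(2-5) by auto
  then have "nbrs G y \<subset> nbrs G x"
    by blast
  then show ?thesis
    using finite_nbrs[OF assms(1)] by (simp add: degree_nbrs psubset_card_mono)
qed

subsection \<open>Indecomposable graphs\<close>

lemma simple_graph_induced:
  assumes "simple_graph G" "S \<subseteq> verts G"
  shows "simple_graph \<lparr>verts = S, edges = {e \<in> edges G. e \<subseteq> S}\<rparr>"
proof -
  have "\<exists>x\<in>S. \<exists>y\<in>S. x \<noteq> y \<and> e = {x, y}" if e: "e \<in> edges G" "e \<subseteq> S" for e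
  proof -
    obtain x y where "x \<noteq> y" "e = {x, y}"
      using assms(1) e(1) unfolding simple_graph_def by meson
    then show ?thesis using e(2) by blast
  qed
  moreover have "finite S"
    using assms finite_subset finite_verts by blast
  ultimately show ?thesis
    unfolding simple_graph_def by simp
qed

text \<open>\<open>SR\<close> and \<open>KR\<close> fix every edge leaving \<open>R\<close>, so the
  subgraphs induced on \<open>S \<union> K\<close> and on \<open>R\<close> recompose to
  \<open>G\<close>.\<close>

lemma decomposableI:
  assumes G: "simple_graph G" and V: "verts G = S \<union> K \<union> R"
    and disj: "S \<inter> K = {}" "S \<inter> R = {}" "K \<inter> R = {}"
    and ne: "R \<noteq> {}" "S \<union> K \<noteq> {}"
    and ind: "\<And>x y. x \<in> S \<Longrightarrow> y \<in> S \<Longrightarrow> y \<notin> nbrs G x"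
    and cl: "\<And>x y. x \<in> K \<Longrightarrow> y \<in> K \<Longrightarrow> x \<noteq> y \<Longrightarrow> y \<in> nbrs G x"
    and SR: "\<And>x y. x \<in> S \<Longrightarrow> y \<in> R \<Longrightarrow> y \<notin> nbrs G x"
    and KR: "\<And>x y. x \<in> K \<Longrightarrow> y \<in> R \<Longrightarrow> y \<in> nbrs G x"
  shows "decomposable G"
proof -
  define P where "P = \<lparr>verts = S \<union> K, edges = {e \<in> edges G. e \<subseteq> S \<union> K}\<rparr>"
  define H where "H = \<lparr>verts = R, edges = {e \<in> edges G. e \<subseteq> R}\<rparr>"
  have "simple_graph P" "simple_graph H"
    unfolding P_def H_def using V by (auto intro!: simple_graph_induced[OF G])
  moreover have "splitted_graph P S K"
    using \<open>simple_graph P\<close> disj ind cl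
    unfolding splitted_graph_def independent_set_def clique_def P_def nbrs_def
    by (auto simp: insert_commute)
  moreover have "G = compose P K H"
  proof -
    have "e \<in> edges P \<union> edges H \<union> {{u, v} |u v. u \<in> K \<and> v \<in> R}" if e: "e \<in> edges G" for e
    proof -
      obtain x y where xy: "e = {x, y}" "x \<in> verts G" "y \<in> verts G"
        using G e unfolding simple_graph_def by meson
      have "y \<in> nbrs G x" "x \<in> nbrs G y"
        using e xy by (auto simp: nbrs_def insert_commute)
      then have "\<not> (x \<in> S \<and> y \<in> R)" "\<not> (y \<in> S \<and> x \<in> R)"
        using SR by auto
      then consider "x \<in> S \<union> K" "y \<in> S \<union> K" | "x \<in> R" "y \<in> R" | "x \<in> K" "y \<in> R" | "x \<in> R" "y \<in> K"
        using xy V by blast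
      then show ?thesis
        using e xy(1) by cases (auto simp: P_def H_def)
    qed
    moreover have "{{u, v} |u v. u \<in> K \<and> v \<in> R} \<subseteq> edges G"
      using KR by (auto simp: nbrs_def insert_commute)
    moreover have "edges P \<subseteq> edges G" "edges H \<subseteq> edges G"
      by (auto simp: P_def H_def)
    ultimately have "edges G = edges P \<union> edges H \<union> {{u, v} |u v. u \<in> K \<and> v \<in> R}"
      by (meson Un_least subsetI subset_antisym)
    then show ?thesis
      using V by (simp add: compose_def P_def H_def)
  qed
  moreover have "verts P \<inter> verts H = {}" "verts P \<noteq> {}" "verts H \<noteq> {}"
    using disj ne by (auto simp: P_def H_def)
  ultimately show ?thesis
    unfolding decomposable_def by blast
qed

lemma trivial_split:
  assumes "simple_graph G" "trivial_graph G"
  shows "split_graph G"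
proof -
  obtain x where x: "verts G = {x}"
    using assms(2) unfolding trivial_graph_def by (auto simp: card_1_singleton_iff)
  have "splitted_graph G {} {x}"
    using assms(1) x by (auto simp: splitted_graph_def independent_set_def clique_def)
  then show ?thesis
    unfolding split_graph_def by blast
qed

text \<open>An isolated vertex would split off as an outer factor with empty clique.\<close>

lemma indecomposable_ex_nbr:
  assumes G: "simple_graph G" "\<not> decomposable G" "\<not> trivial_graph G" and x: "x \<in> verts G"
  shows "\<exists>y. y \<in> nbrs G x"
proof (rule ccontr)
  assume no: "\<not> ?thesis"
  have "verts G - {x} \<noteq> {}"
    using assms by (auto simp: trivial_graph_def card_1_singleton_iff)
  then have "decomposable G"
    using no x by (intro decomposableI[OF G(1), where S="{x}" and K="{}" and R="verts G - {x}"]) auto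
  then show False using G by blast
qed

text \<open>Each failure singles out a vertex that splits off. A vertex of \<open>K\<close> without
  neighbours in \<open>S\<close>, or a vertex of \<open>S\<close> adjacent to all of
  \<open>K\<close>, can serve as the inner factor; a vertex adjacent to everything, or to nothing,
  as the outer one.\<close>

lemma indecomposable_splitted:
  assumes G: "splitted_graph G S K" "\<not> decomposable G" "\<not> trivial_graph G"
  shows "x \<in> K \<Longrightarrow> \<exists>y\<in>S. y \<in> nbrs G x"
    and "x \<in> K \<Longrightarrow> \<exists>y\<in>S. y \<notin> nbrs G x"
    and "y \<in> S \<Longrightarrow> \<exists>x\<in>K. x \<in> nbrs G y"
    and "y \<in> S \<Longrightarrow> \<exists>x\<in>K. x \<notin> nbrs G y"
proof -
  have s: "simple_graph G" and V: "S \<union> K = verts G" "S \<inter> K = {}"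
    and ind: "\<And>x y. x \<in> S \<Longrightarrow> y \<in> S \<Longrightarrow> y \<notin> nbrs G x"
    and cl: "\<And>x y. x \<in> K \<Longrightarrow> y \<in> K \<Longrightarrow> x \<noteq> y \<Longrightarrow> y \<in> nbrs G x"
    using G(1) by (auto simp: splitted_graph_def clique_nbrs independent_nbrs)
  have big: "verts G - {x} \<noteq> {}" if "x \<in> verts G" for x
    using that G(3) by (auto simp: trivial_graph_def card_1_singleton_iff)
  show "\<exists>y\<in>S. y \<in> nbrs G x" if x: "x \<in> K"
  proof (rule ccontr)
    assume no: "\<not> ?thesis"
    have "decomposable G"
      using no x V cl big[of x] ind
      by (intro decomposableI[OF s, where S=S and K="K - {x}" and R="{x}"])
        (auto simp: nbrs_sym[of x])
    then show False using G by blast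
  qed
  show "\<exists>y\<in>S. y \<notin> nbrs G x" if x: "x \<in> K"
  proof (rule ccontr)
    assume no: "\<not> ?thesis"
    have "decomposable G"
      using no x V cl big[of x] ind
      by (intro decomposableI[OF s, where S="{}" and K="{x}" and R="verts G - {x}"]) auto
    then show False using G by blast
  qed
  show "\<exists>x\<in>K. x \<in> nbrs G y" if y: "y \<in> S"
    using indecomposable_ex_nbr[OF s G(2,3), of y] ind[OF y] V(1) y nbrs_verts[OF s] by blast
  show "\<exists>x\<in>K. x \<notin> nbrs G y" if y: "y \<in> S"
  proof (rule ccontr)
    assume no: "\<not> ?thesis"
    have "decomposable G"
      using no y V cl big[of y] ind
      by (intro decomposableI[OF s, where S="S - {y}" and K=K and R="{y}"])
        (auto simp: nbrs_sym[of y])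
    then show False using G by blast
  qed
qed

subsection \<open>Equality in the Erdos-Gallai inequalities\<close>

definition tight :: "'a graph \<Rightarrow> 'a set \<Rightarrow> bool" where
  "tight G X \<longleftrightarrow> clique G X \<and> (\<forall>u\<in>verts G - X. X \<subseteq> nbrs G u \<or> nbrs G u \<subseteq> X)"

text \<open>In a finite graph a \<open>top_set\<close> is an initial segment of some descending
  listing of the vertices, a \<open>strict_top_set\<close> of every such listing.\<close>

definition top_set :: "'a graph \<Rightarrow> 'a set \<Rightarrow> bool" where
  "top_set G X \<longleftrightarrow> X \<subseteq> verts G \<and> (\<forall>x\<in>X. \<forall>y\<in>verts G - X. degree G y \<le> degree G x)"

definition strict_top_set :: "'a graph \<Rightarrow> 'a set \<Rightarrow> bool" where
  "strict_top_set G X \<longleftrightarrow> X \<subseteq> verts G \<and> (\<forall>x\<in>X. \<forall>y\<in>verts G - X. degree G y < degree G x)"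

text \<open>A vertex of \<open>S - X\<close> and one of \<open>X - S\<close> would be ordered
  strictly by \<open>S\<close> and weakly the other way by \<open>X\<close>.\<close>

lemma strict_top_set_comparable:
  "strict_top_set G S \<Longrightarrow> top_set G X \<Longrightarrow> S \<subseteq> X \<or> X \<subseteq> S"
  unfolding strict_top_set_def top_set_def by (metis DiffI in_mono not_le subsetI)

lemma sum_le_eq_iff:
  fixes f g :: "'b \<Rightarrow> nat"
  assumes "finite S" "\<And>x. x \<in> S \<Longrightarrow> f x \<le> g x"
  shows "sum f S = sum g S \<longleftrightarrow> (\<forall>x\<in>S. f x = g x)"
  using assms sum_mono_inv[of f S g] by (auto intro: sum.cong)

text \<open>Two bounds hold for every \<open>X\<close>, of large degree or not: a vertex of
  \<open>X\<close> has at most \<open>card X - 1\<close> neighbours in \<open>X\<close>, and a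
  vertex \<open>u\<close> outside has at most \<open>min (card X) (degree G u)\<close>. Equality of
  the sums is therefore equality in every term.\<close>

lemma tight_iff_sum:
  assumes G: "simple_graph G" and X: "X \<subseteq> verts G"
  shows "tight G X \<longleftrightarrow> (\<Sum>x\<in>X. degree G x) =
    card X * (card X - 1) + (\<Sum>u\<in>verts G - X. min (card X) (degree G u))"
proof -
  let ?V = "verts G" and ?k = "card X"
  have fV: "finite ?V" and fX: "finite X"
    using finite_verts[OF G] X by (auto intro: finite_subset)
  have fN: "finite (nbrs G x)" for x
    using finite_nbrs[OF G] .
  define a where "a x = card (nbrs G x \<inter> X)" for x
  have split: "degree G x = a x + card (nbrs G x - X)" for x
    unfolding degree_nbrs a_def using fN by (metis card_Int_Diff)
  \<comment> \<open>The edges between \<open>X\<close> and its complement are counted from both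
    ends.\<close>
  have "(\<Sum>x\<in>X. card (nbrs G x - X)) = (\<Sum>x\<in>X. \<Sum>u\<in>?V - X. if u \<in> nbrs G x then 1 else 0)"
  proof (rule sum.cong[OF refl])
    fix x
    have "nbrs G x - X = {u \<in> ?V - X. u \<in> nbrs G x}"
      using nbrs_subset[OF G] by blast
    then show "card (nbrs G x - X) = (\<Sum>u\<in>?V - X. if u \<in> nbrs G x then 1 else 0)"
      using fV by (simp add: sum.If_cases Int_def)
  qed
  also have "\<dots> = (\<Sum>u\<in>?V - X. \<Sum>x\<in>X. if u \<in> nbrs G x then 1 else 0)"
    by (rule sum.swap)
  also have "\<dots> = (\<Sum>u\<in>?V - X. a u)"
  proof (rule sum.cong[OF refl])
    fix u
    have "{x \<in> X. u \<in> nbrs G x} = nbrs G u \<inter> X"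
      by (auto simp: nbrs_sym[of u])
    then show "(\<Sum>x\<in>X. if u \<in> nbrs G x then 1 else 0) = a u"
      using fX by (simp add: sum.If_cases a_def Int_def)
  qed
  finally have deg: "(\<Sum>x\<in>X. degree G x) = (\<Sum>x\<in>X. a x) + (\<Sum>u\<in>?V - X. a u)"
    by (simp add: split sum.distrib)
  have a1: "a x \<le> ?k - 1" and a1eq: "a x = ?k - 1 \<longleftrightarrow> X - {x} \<subseteq> nbrs G x" if "x \<in> X" for x
  proof -
    have sub: "nbrs G x \<inter> X \<subseteq> X - {x}" and c: "card (X - {x}) = ?k - 1"
      using nbrs_irrefl[OF G] that by auto
    show "a x \<le> ?k - 1"
      unfolding a_def using card_mono[OF _ sub] fX c by simp
    have "card (nbrs G x \<inter> X) = card (X - {x}) \<longleftrightarrow> nbrs G x \<inter> X = X - {x}"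
      by (metis card_subset_eq fX finite_Diff sub)
    also have "\<dots> \<longleftrightarrow> X - {x} \<subseteq> nbrs G x"
      using sub by blast
    finally show "a x = ?k - 1 \<longleftrightarrow> X - {x} \<subseteq> nbrs G x"
      using c by (simp add: a_def)
  qed
  have a2: "a u \<le> min ?k (degree G u)" for u
    unfolding a_def degree_nbrs using fX fN by (simp add: card_mono)
  have a2eq: "a u = min ?k (degree G u) \<longleftrightarrow> X \<subseteq> nbrs G u \<or> nbrs G u \<subseteq> X" for u
  proof -
    have "a u = ?k \<longleftrightarrow> X \<subseteq> nbrs G u"
      unfolding a_def by (metis Int_lower1 Int_lower2 card_subset_eq fX Int_absorb1)
    moreover have "a u = degree G u \<longleftrightarrow> nbrs G u \<subseteq> X"
      unfolding a_def degree_nbrs by (metis Int_lower1 Int_lower2 card_subset_eq fN Int_absorb2)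
    ultimately show ?thesis
      using a2[of u] by (auto simp: min_def split: if_splits)
  qed
  have s1: "(\<Sum>x\<in>X. a x) \<le> (\<Sum>x\<in>X. ?k - 1)"
    by (intro sum_mono a1)
  have s2: "(\<Sum>u\<in>?V - X. a u) \<le> (\<Sum>u\<in>?V - X. min ?k (degree G u))"
    by (intro sum_mono a2)
  have add_eq: "p + q = r + t \<longleftrightarrow> p = r \<and> q = t" if "p \<le> r" "q \<le> t" for p q r t :: nat
    using that by auto
  have "(\<Sum>x\<in>X. degree G x) = ?k * (?k - 1) + (\<Sum>u\<in>?V - X. min ?k (degree G u)) \<longleftrightarrow>
    (\<Sum>x\<in>X. a x) = (\<Sum>x\<in>X. ?k - 1) \<and> (\<Sum>u\<in>?V - X. a u) = (\<Sum>u\<in>?V - X. min ?k (degree G u))"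
    using add_eq[OF s1 s2] by (simp add: deg)
  also have "\<dots> \<longleftrightarrow> (\<forall>x\<in>X. X - {x} \<subseteq> nbrs G x) \<and> (\<forall>u\<in>?V - X. X \<subseteq> nbrs G u \<or> nbrs G u \<subseteq> X)"
    using sum_le_eq_iff[OF fX a1] sum_le_eq_iff[of "?V - X", OF _ a2] fV a1eq a2eq by simp
  also have "(\<forall>x\<in>X. X - {x} \<subseteq> nbrs G x) \<longleftrightarrow> clique G X"
    using X by (auto simp: clique_nbrs)
  finally show ?thesis
    by (simp add: tight_def)
qed

text \<open>Two top sets of the same size differ only by vertices of one common degree.\<close>

lemma top_set_sum_eq:
  fixes f :: "nat \<Rightarrow> nat"
  assumes fin: "finite (verts G)" and X: "top_set G X" and Y: "top_set G Y"
    and card: "card X = card Y"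
  shows "(\<Sum>x\<in>X. f (degree G x)) = (\<Sum>x\<in>Y. f (degree G x))"
    and "(\<Sum>x\<in>verts G - X. f (degree G x)) = (\<Sum>x\<in>verts G - Y. f (degree G x))"
proof -
  have sub: "X \<subseteq> verts G" "Y \<subseteq> verts G" and fX: "finite X" "finite Y"
    using X Y fin by (auto simp: top_set_def intro: finite_subset)
  have c: "card (X - Y) = card (Y - X)"
    using card fX by (metis card_le_sym_Diff le_antisym order_refl)
  have "(\<Sum>x\<in>X - Y. f (degree G x)) = (\<Sum>x\<in>Y - X. f (degree G x))"
  proof (cases "X - Y = {}")
    case True
    then have "Y - X = {}" using c fX by (metis card_0_eq card.empty finite_Diff)
    with True show ?thesis by simp
  next
    case False
    then obtain x0 where x0: "x0 \<in> X - Y" by blast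
    have eq: "degree G x = degree G y" if "x \<in> X - Y" "y \<in> Y - X" for x y
      using X Y that sub unfolding top_set_def by (meson DiffD1 DiffD2 DiffI in_mono le_antisym)
    have "Y - X \<noteq> {}" using False c fX by (metis card_0_eq card.empty finite_Diff)
    then obtain y0 where y0: "y0 \<in> Y - X" by blast
    have "(\<Sum>x\<in>X - Y. f (degree G x)) = card (X - Y) * f (degree G y0)"
      using eq y0 by simp
    moreover have "(\<Sum>x\<in>Y - X. f (degree G x)) = card (Y - X) * f (degree G y0)"
      using eq[OF x0, symmetric] eq[OF x0 y0] by simp
    ultimately show ?thesis using c by simp
  qed
  then show main: "(\<Sum>x\<in>X. f (degree G x)) = (\<Sum>x\<in>Y. f (degree G x))"
    using sum.Int_Diff[OF fX(1), of "\<lambda>x. f (degree G x)" Y]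
      sum.Int_Diff[OF fX(2), of "\<lambda>x. f (degree G x)" X] by (simp add: Int_commute)
  show "(\<Sum>x\<in>verts G - X. f (degree G x)) = (\<Sum>x\<in>verts G - Y. f (degree G x))"
    using main sum.subset_diff[OF sub(1) fin, of "\<lambda>x. f (degree G x)"]
      sum.subset_diff[OF sub(2) fin, of "\<lambda>x. f (degree G x)"] by simp
qed

text \<open>The filtered interval is strictly increasing, so neighbouring list entries are those
  with no admissible value between them; later arguments about consecutive terms need inequalities
  only.\<close>

lemma consecutive_filter:
  "consecutive_terms (filter Q [a..<b]) x y \<longleftrightarrow>
    a \<le> x \<and> x < y \<and> y < b \<and> Q x \<and> Q y \<and> (\<forall>z. x < z \<and> z < y \<longrightarrow> \<not> Q z)"
proof
  assume "consecutive_terms (filter Q [a..<b]) x y"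
  then obtain us vs where e: "filter Q [a..<b] = us @ [x, y] @ vs"
    by (auto simp: consecutive_terms_def)
  have "sorted_wrt (<) (filter Q [a..<b])"
    by (simp add: sorted_wrt_filter)
  then have s: "x < y" "\<forall>z\<in>set us. z < x" "\<forall>z\<in>set vs. y < z"
    unfolding e by (auto simp: sorted_wrt_append)
  have m: "z \<in> set us \<union> {x, y} \<union> set vs \<longleftrightarrow> a \<le> z \<and> z < b \<and> Q z" for z
    using arg_cong[OF e, of set] by auto
  have "\<not> Q z" if z: "x < z" "z < y" for z
    using m[of x] m[of y] m[of z] s z by auto
  then show "a \<le> x \<and> x < y \<and> y < b \<and> Q x \<and> Q y \<and> (\<forall>z. x < z \<and> z < y \<longrightarrow> \<not> Q z)"
    using m[of x] m[of y] s(1) by simp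
next
  assume r: "a \<le> x \<and> x < y \<and> y < b \<and> Q x \<and> Q y \<and> (\<forall>z. x < z \<and> z < y \<longrightarrow> \<not> Q z)"
  then have "[a..<b] = [a..<x] @ [x..<y] @ [y..<b]"
    using upt_add_eq_append[of a x "b - x"] upt_add_eq_append[of x y "b - y"] by simp
  with r have "[a..<b] = [a..<x] @ [x] @ [Suc x..<y] @ [y] @ [Suc y..<b]"
    by (simp add: upt_conv_Cons)
  moreover have "filter Q [Suc x..<y] = []"
    using r by (auto simp: filter_empty_conv)
  ultimately have "filter Q [a..<b] = filter Q [a..<x] @ [x, y] @ filter Q [Suc y..<b]"
    using r by simp
  then show "consecutive_terms (filter Q [a..<b]) x y"
    unfolding consecutive_terms_def by blast
qed

section \<open>Initial segments of a listing by descending degree\<close>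

locale indexed_graph =
  fixes G :: "'a graph" and n :: nat and d :: "nat \<Rightarrow> nat" and v :: "nat \<Rightarrow> 'a"
  assumes graph: "simple_graph G"
    and index: "bij_betw v {1..n} (verts G)"
    and degrees: "\<And>i. i \<in> {1..n} \<Longrightarrow> degree G (v i) = d i"
    and descending: "\<And>i j. 1 \<le> i \<Longrightarrow> i \<le> j \<Longrightarrow> j \<le> n \<Longrightarrow> d j \<le> d i"
begin

definition first :: "nat \<Rightarrow> 'a set" where
  "first k = v ` {1..k}"

lemma inj_v: "i \<in> {1..n} \<Longrightarrow> j \<in> {1..n} \<Longrightarrow> v i = v j \<longleftrightarrow> i = j"
  using index by (auto simp: bij_betw_def inj_on_eq_iff)

lemma v_verts: "i \<in> {1..n} \<Longrightarrow> v i \<in> verts G"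
  using index by (auto simp: bij_betw_def)

lemma verts_v: "x \<in> verts G \<Longrightarrow> \<exists>i\<in>{1..n}. x = v i"
  using index by (auto simp: bij_betw_def)

lemma v_in_first: "i \<in> {1..n} \<Longrightarrow> k \<le> n \<Longrightarrow> v i \<in> first k \<longleftrightarrow> i \<le> k"
  by (fastforce simp: first_def inj_v)

lemma first_subset: "k \<le> n \<Longrightarrow> first k \<subseteq> verts G"
  using v_verts by (auto simp: first_def)

lemma card_first: "k \<le> n \<Longrightarrow> card (first k) = k"
  using index inj_on_subset[of v "{1..n}" "{1..k}"]
  by (auto simp: first_def card_image bij_betw_def)

lemma first_diff: "k \<le> k' \<Longrightarrow> k' \<le> n \<Longrightarrow> first k' - first k = {v i | i. k < i \<and> i \<le> k'}"
  unfolding first_def by (fastforce simp: inj_v)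

lemma first_mono: "k \<le> k' \<Longrightarrow> first k \<subseteq> first k'"
  by (auto simp: first_def)

lemma degree_less_index:
  assumes "i \<in> {1..n}" "j \<in> {1..n}" "degree G (v i) < degree G (v j)"
  shows "j < i"
  using assms degrees descending[of i j] by (metis atLeastAtMost_iff leD leI)

lemma top_first: "k \<le> n \<Longrightarrow> top_set G (first k)"
  unfolding top_set_def
proof (intro conjI ballI)
  fix x y assume k: "k \<le> n" and x: "x \<in> first k" and y: "y \<in> verts G - first k"
  obtain i where i: "i \<in> {1..k}" "x = v i" using x by (auto simp: first_def)
  obtain j where j: "j \<in> {1..n}" "y = v j" "k < j"
    using y k verts_v v_in_first by (metis DiffD1 DiffD2 not_le)
  show "degree G y \<le> degree G x"
    using degree_less_index[of i j] i j k by force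
qed (rule first_subset)

lemma sum_first:
  assumes "k \<le> n"
  shows "(\<Sum>i=1..k. d i) = (\<Sum>x\<in>first k. degree G x)"
    and "(\<Sum>i=k+1..n. min k (d i)) = (\<Sum>x\<in>verts G - first k. min k (degree G x))"
proof -
  have inj: "inj_on v {1..n}" using index by (simp add: bij_betw_def)
  show "(\<Sum>i=1..k. d i) = (\<Sum>x\<in>first k. degree G x)"
    unfolding first_def using inj_on_subset[OF inj, of "{1..k}"] assms
    by (simp add: sum.reindex degrees)
  have "verts G - first k = v ` {k+1..n}"
    using verts_v v_verts v_in_first assms by fastforce
  then show "(\<Sum>i=k+1..n. min k (d i)) = (\<Sum>x\<in>verts G - first k. min k (degree G x))"
    using inj_on_subset[OF inj, of "{k+1..n}"] by (simp add: sum.reindex degrees)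
qed

text \<open>By \<open>top_set_sum_eq\<close> the set \<open>first (card X)\<close> may be exchanged
  for \<open>X\<close> in both sums. Applied to \<open>U m\<close> it produces equality indices,
  applied to an initial segment it extracts structure from one.\<close>

lemma EG_equality_iff_tight:
  assumes X: "top_set G X"
  shows "EG_equality n d (card X) \<longleftrightarrow> tight G X"
proof -
  have sub: "X \<subseteq> verts G" using X by (simp add: top_set_def)
  have "card X \<le> card (verts G)"
    using sub finite_verts[OF graph] by (simp add: card_mono)
  then have k: "card X \<le> n"
    using bij_betw_same_card[OF index] by simp
  note eqs = top_set_sum_eq[OF finite_verts[OF graph] X top_first[OF k] card_first[OF k, symmetric]]
  show ?thesis
    unfolding EG_equality_def tight_iff_sum[OF graph sub] sum_first[OF k]
    using eqs(1)[of "\<lambda>t. t"] eqs(2)[of "min (card X)"] by simp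
qed

lemma EG_iff: "k \<in> set (EG n d) \<longleftrightarrow> k \<le> n \<and> EG_equality n d k"
  by (auto simp: EG_def simp del: upt_Suc)

lemma tight_first: "k \<in> set (EG n d) \<Longrightarrow> tight G (first k)"
  using EG_equality_iff_tight[OF top_first, of k] by (simp add: EG_iff card_first)

lemma dstar_card: "dstar n d k = card {x \<in> verts G. k \<le> degree G x}"
proof -
  have "{x \<in> verts G. k \<le> degree G x} = v ` {i \<in> {1..n}. k \<le> d i}"
    using verts_v v_verts degrees by fastforce
  moreover have "inj_on v {i \<in> {1..n}. k \<le> d i}"
    by (rule inj_onI) (auto simp: inj_v)
  ultimately show ?thesis
    by (simp add: dstar_def card_image)
qed

end

subsection \<open>Adjacency in a composition\<close>

lemma verts_composition: "verts (composition C B m) = (\<Union>i\<le>m. verts (C i))"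
  by (induction m) (auto simp: compose_def atMost_Suc)

lemma edges_composition:
  "e \<in> edges (composition C B m) \<longleftrightarrow>
    (\<exists>i\<le>m. e \<in> edges (C i)) \<or> (\<exists>i\<le>m. \<exists>j<i. \<exists>x\<in>B i. \<exists>y\<in>verts (C j). e = {x, y})"
proof (induction m)
  case (Suc m)
  have "e \<in> edges (composition C B (Suc m)) \<longleftrightarrow>
    e \<in> edges (C (Suc m)) \<or> e \<in> edges (composition C B m) \<or>
    (\<exists>x\<in>B (Suc m). \<exists>j<Suc m. \<exists>y\<in>verts (C j). e = {x, y})"
    by (auto simp: compose_def verts_composition less_Suc_eq_le)
  then show ?case
    unfolding Suc.IH le_Suc_eq by blast
qed simp

text \<open>Giving a core that is not split the empty parts \<open>A 0 = B 0 = {}\<close> lets it be treated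
  like the other components: then \<open>U 0 = U 1\<close> below.\<close>

locale layered_graph =
  fixes G :: "'a graph" and l :: nat and C :: "nat \<Rightarrow> 'a graph" and A B :: "nat \<Rightarrow> 'a set"
  assumes simple: "simple_graph G"
    and comp_simple: "\<And>i. i \<le> l \<Longrightarrow> simple_graph (C i)"
    and comp_nonempty: "\<And>i. i \<le> l \<Longrightarrow> verts (C i) \<noteq> {}"
    and indecomposable: "\<And>i. i \<le> l \<Longrightarrow> \<not> decomposable (C i)"
    and splitted_pos: "\<And>i. 1 \<le> i \<Longrightarrow> i \<le> l \<Longrightarrow> splitted_graph (C i) (A i) (B i)"
    and disjoint: "\<And>i j. i \<le> l \<Longrightarrow> j \<le> l \<Longrightarrow> i \<noteq> j \<Longrightarrow> verts (C i) \<inter> verts (C j) = {}"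
    and G_eq: "G = composition C B l"
    and core: "splitted_graph (C 0) (A 0) (B 0) \<or> \<not> split_graph (C 0) \<and> A 0 = {} \<and> B 0 = {}"
    and trivial_core: "trivial_graph (C 0) \<Longrightarrow> B 0 = verts (C 0)"
begin

lemma verts_G: "x \<in> verts G \<longleftrightarrow> (\<exists>i\<le>l. x \<in> verts (C i))"
  by (auto simp: G_eq verts_composition)

lemma comp_verts: "i \<le> l \<Longrightarrow> verts (C i) \<subseteq> verts G"
  using verts_G by blast

lemma level_unique: "i \<le> l \<Longrightarrow> j \<le> l \<Longrightarrow> x \<in> verts (C i) \<Longrightarrow> x \<in> verts (C j) \<Longrightarrow> i = j"
  using disjoint by blast

lemma split_cases:
  "i \<le> l \<Longrightarrow> splitted_graph (C i) (A i) (B i) \<or> i = 0 \<and> \<not> split_graph (C 0) \<and> A i = {} \<and> B i = {}"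
  using core splitted_pos[of i] by (cases i) auto

lemma A_verts: "i \<le> l \<Longrightarrow> A i \<subseteq> verts (C i)"
  and B_verts: "i \<le> l \<Longrightarrow> B i \<subseteq> verts (C i)"
  and A_B_disjoint: "i \<le> l \<Longrightarrow> A i \<inter> B i = {}"
  and comp_cases: "i \<le> l \<Longrightarrow> x \<in> verts (C i) \<Longrightarrow> x \<in> A i \<or> x \<in> B i \<or> i = 0 \<and> \<not> split_graph (C 0)"
  using split_cases[of i] by (auto simp: splitted_graph_def)

lemma A_nonempty_split: "i \<le> l \<Longrightarrow> A i \<noteq> {} \<Longrightarrow> splitted_graph (C i) (A i) (B i)"
  and B_nonempty_split: "i \<le> l \<Longrightarrow> B i \<noteq> {} \<Longrightarrow> splitted_graph (C i) (A i) (B i)"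
  using split_cases[of i] by auto

lemma nonsplit_core: "\<not> split_graph (C 0) \<Longrightarrow> A 0 = {} \<and> B 0 = {}"
  using core by (auto simp: split_graph_def)

lemma edges_G:
  "y \<in> nbrs G x \<longleftrightarrow> (\<exists>i\<le>l. y \<in> nbrs (C i) x) \<or>
    (\<exists>i\<le>l. \<exists>j<i. x \<in> B i \<and> y \<in> verts (C j) \<or> y \<in> B i \<and> x \<in> verts (C j))"
proof -
  have "(\<exists>x'\<in>B i. \<exists>y'\<in>V. {y, x} = {x', y'}) \<longleftrightarrow> x \<in> B i \<and> y \<in> V \<or> y \<in> B i \<and> x \<in> V" for i V
    by (auto simp: doubleton_eq_iff)
  then show ?thesis
    unfolding nbrs_def mem_Collect_eq by (subst G_eq) (simp add: edges_composition)
qed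

lemma nbrs_same:
  assumes i: "i \<le> l" "x \<in> verts (C i)" "y \<in> verts (C i)"
  shows "y \<in> nbrs G x \<longleftrightarrow> y \<in> nbrs (C i) x"
proof -
  have "j = i" if "j \<le> l" "y \<in> nbrs (C j) x" for j
    using nbrs_verts[OF comp_simple[OF that(1)] that(2)] level_unique i that by blast
  moreover have "\<not> (x \<in> B j \<and> y \<in> verts (C k) \<or> y \<in> B j \<and> x \<in> verts (C k))"
    if "j \<le> l" "k < j" for j k
    using level_unique[of i j] level_unique[of i k] B_verts[of j] i that
    by (metis less_imp_le_nat order.trans nat_neq_iff subsetD)
  ultimately show ?thesis
    unfolding edges_G using i by blast
qed

text \<open>Disjointness fixes the levels of both endpoints, so only the edges added on composing
  with level \<open>i\<close> can join them.\<close>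

lemma nbrs_below:
  assumes i: "i \<le> l" "x \<in> verts (C i)" and j: "j < i" "y \<in> verts (C j)"
  shows "y \<in> nbrs G x \<longleftrightarrow> x \<in> B i"
proof -
  have jl: "j \<le> l" using i j by simp
  have "k = i \<and> k = j" if "k \<le> l" "y \<in> nbrs (C k) x" for k
    using nbrs_verts[OF comp_simple[OF that(1)] that(2)] level_unique i j jl that by blast
  moreover have "k = i" if "k \<le> l" "x \<in> B k" for k
    using that level_unique i B_verts by blast
  moreover have False if "k \<le> l" "y \<in> B k" "k' < k" "x \<in> verts (C k')" for k k'
    using that level_unique[of k j y] level_unique[of k' i x] i j jl B_verts[of k] by auto
  ultimately show ?thesis
    unfolding edges_G using i j by (metis nat_neq_iff)
qed

lemma nbrs_above:
  assumes "i \<le> l" "x \<in> B i" "j < i" "y \<in> verts (C j)"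
  shows "y \<in> nbrs G x" "x \<in> nbrs G y"
proof -
  show "y \<in> nbrs G x"
    using nbrs_below[of i x j y] B_verts[of i] assms by blast
  then show "x \<in> nbrs G y"
    by (simp add: nbrs_sym)
qed

text \<open>Across levels the composition supplies the edge, within a level the clique does; hence
  every \<open>U m\<close> is a clique.\<close>

lemma B_adjacent:
  assumes "i \<le> l" "x \<in> B i" "j \<le> l" "y \<in> B j" "x \<noteq> y"
  shows "y \<in> nbrs G x"
proof (cases i j rule: linorder_cases)
  case less
  then show ?thesis using nbrs_above(2)[of j y i x] B_verts[of i] assms by blast
next
  case greater
  then show ?thesis using nbrs_above(1)[of i x j y] B_verts[of j] assms by blast
next
  case equal
  have "splitted_graph (C i) (A i) (B i)"
    using assms B_nonempty_split by blast
  then have "y \<in> nbrs (C i) x"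
    using assms equal by (auto simp: splitted_graph_def clique_nbrs)
  then show ?thesis
    using assms equal nbrs_same[of i x y] B_verts[of i] by blast
qed

lemma A_nbr:
  assumes i: "i \<le> l" "x \<in> A i" and y: "y \<in> nbrs G x"
  shows "\<exists>j. i \<le> j \<and> j \<le> l \<and> y \<in> B j"
proof -
  obtain j where j: "j \<le> l" "y \<in> verts (C j)"
    using nbrs_verts[OF simple y] verts_G by blast
  have x: "x \<in> verts (C i)" "x \<notin> B i"
    using i A_verts A_B_disjoint by blast+
  show ?thesis
  proof (cases i j rule: linorder_cases)
    case less
    then show ?thesis
      using nbrs_below[of j y i x] j x y nbrs_sym[of x G y] by (meson less_imp_le)
  next
    case equal
    have "splitted_graph (C i) (A i) (B i)"
      using i A_nonempty_split by blast
    then have "y \<in> B i"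
      using y nbrs_same[of i x y] i j x equal by (auto simp: splitted_graph_def independent_nbrs)
    then show ?thesis using i by blast
  next
    case greater
    then show ?thesis
      using nbrs_below[of i x j y] i j x y by blast
  qed
qed

section \<open>Unions of the cliques from level \<open>m\<close> outwards, and the degree drops at
  their boundaries\<close>

definition U :: "nat \<Rightarrow> 'a set" where
  "U m = (\<Union>i\<in>{m..l}. B i)"

lemma U_I: "x \<in> B i \<Longrightarrow> m \<le> i \<Longrightarrow> i \<le> l \<Longrightarrow> x \<in> U m"
  by (auto simp: U_def)

lemma U_E:
  assumes "x \<in> U m"
  obtains i where "m \<le> i" "i \<le> l" "x \<in> B i" "x \<in> verts (C i)"
proof -
  obtain i where "m \<le> i" "i \<le> l" "x \<in> B i"
    using assms by (auto simp: U_def)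
  then show thesis using that B_verts by blast
qed

lemma U_verts: "U m \<subseteq> verts G"
  using comp_verts by (auto elim!: U_E)

lemma finite_U: "finite (U m)"
  using U_verts finite_verts[OF simple] by (rule finite_subset)

lemma U_mono: "m \<le> m' \<Longrightarrow> U m' \<subseteq> U m"
  unfolding U_def by (rule UN_mono) auto

lemma card_U_mono: "m \<le> m' \<Longrightarrow> card (U m') \<le> card (U m)"
  using U_mono finite_U by (simp add: card_mono)

lemma U_Suc: "m \<le> l \<Longrightarrow> U m = B m \<union> U (Suc m)"
  unfolding U_def using atLeastAtMost_insertL[of m l] by (metis UN_insert)

lemma U_level: "x \<in> U m \<Longrightarrow> x \<in> verts (C i) \<Longrightarrow> i \<le> l \<Longrightarrow> m \<le> i \<and> x \<in> B i"
  using level_unique by (blast elim!: U_E)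

lemma U_Suc_disjoint: "m \<le> l \<Longrightarrow> B m \<inter> U (Suc m) = {}"
  using U_level[of _ "Suc m" m] B_verts[of m] by fastforce

lemma card_U_Suc: "m \<le> l \<Longrightarrow> card (U m) = card (B m) + card (U (Suc m))"
  using U_Suc[of m] U_Suc_disjoint[of m] finite_U[of m] by (simp add: card_Un_disjoint)

text \<open>Letting \<open>m\<close> run up to \<open>Suc l\<close> accounts for the equality index
  0.\<close>

lemma U_last: "U (Suc l) = {}"
  by (auto simp: U_def)

lemma A_U_disjoint: "i \<le> l \<Longrightarrow> x \<in> A i \<Longrightarrow> x \<notin> U m"
  using U_level[of x m i] A_verts[of i] A_B_disjoint[of i] by blast

text \<open>For \<open>m > 0\<close> the core, split or not, falls under the first case; only
  \<open>m = 0\<close> leaves the vertices of a non-split core in neither a clique nor an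
  independent set.\<close>

lemma not_U_cases:
  assumes "y \<in> verts G" "y \<notin> U m"
  obtains j where "j \<le> l" "y \<in> verts (C j)" "j < m"
  | j where "j \<le> l" "y \<in> verts (C j)" "y \<in> A j" "m \<le> j"
  | "y \<in> verts (C 0)" "\<not> split_graph (C 0)" "m = 0"
proof -
  obtain j where j: "j \<le> l" "y \<in> verts (C j)"
    using assms verts_G by blast
  then show thesis
  proof (cases "j < m")
    case False
    then have "y \<notin> B j" using U_I[of y j m] assms(2) j by auto
    then consider "y \<in> A j" | "j = 0" "\<not> split_graph (C 0)" using comp_cases[OF j] by blast
    then show thesis using that False j by cases auto
  qed (use that j in blast)
qed

text \<open>Domination in the vicinal preorder gives all degree comparisons without computing degrees.\<close>

lemma nbrs_dominate:
  assumes x: "i \<le> l" "x \<in> B i" and y: "j \<le> l" "y \<in> verts (C j)" "j < i \<or> y \<in> A j \<and> i \<le> j"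
  shows "nbrs G y - {x} \<subseteq> nbrs G x"
proof
  fix z assume z: "z \<in> nbrs G y - {x}"
  then obtain k where k: "k \<le> l" "z \<in> verts (C k)"
    using nbrs_verts[OF simple, of z y] verts_G by blast
  show "z \<in> nbrs G x"
  proof (cases "k < i")
    case True
    then show ?thesis using nbrs_above(1) x k by blast
  next
    case False
    \<comment> \<open>At level \<open>i\<close> or further out, \<open>y\<close> sees clique
      vertices only: if \<open>j < i\<close> because the edge comes from the composition, otherwise
      because \<open>y\<close> is in an independent set.\<close>
    have "z \<in> B k"
    proof (cases "j < i")
      case True
      then show ?thesis
        using False nbrs_below[of k z j y] k y z nbrs_sym[of z G y] by auto
    next
      case jn: False
      then obtain k' where "k' \<le> l" "z \<in> B k'"
        using A_nbr[of j y z] y z by blast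
      then show ?thesis
        using level_unique[of k k' z] k B_verts[of k'] by blast
    qed
    then show ?thesis
      using B_adjacent[of i x k z] x k z by blast
  qed
qed

lemma top_U: "top_set G (U m)"
  unfolding top_set_def
proof (intro conjI ballI)
  fix x y assume x: "x \<in> U m" and y: "y \<in> verts G - U m"
  obtain i where i: "m \<le> i" "i \<le> l" "x \<in> B i"
    using x by (auto elim: U_E)
  have "\<exists>j\<le>l. y \<in> verts (C j) \<and> (j < i \<or> y \<in> A j \<and> i \<le> j)"
  proof -
    have "y \<in> verts G" "y \<notin> U m" using y by auto
    then show ?thesis
    proof (cases rule: not_U_cases)
      case (1 j)
      then show ?thesis using i by (meson order.strict_trans2)
    next
      case (2 j)
      then show ?thesis by (meson not_le)
    next
      case 3
      \<comment> \<open>A non-split core has empty \<open>B 0\<close>, so the clique containing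
        \<open>x\<close> lies further out.\<close>
      then have "0 < i" using i nonsplit_core by (cases i) auto
      then show ?thesis using 3 by blast
    qed
  qed
  then show "degree G y \<le> degree G x"
    using degree_mono[OF simple nbrs_dominate] i by blast
qed (rule U_verts)

lemma comp_nonnbrs:
  assumes "i \<le> l" "z \<in> A i" "j \<le> l" "y \<in> verts (C j)" "j < i \<or> y \<in> A j"
  shows "z \<notin> nbrs G y"
proof
  assume z: "z \<in> nbrs G y"
  have zi: "z \<in> verts (C i)" "z \<notin> B i"
    using assms A_verts A_B_disjoint by blast+
  show False
  proof (cases "j < i")
    case True
    then show False using z zi nbrs_below[of i z j y] assms nbrs_sym[of z G y] by blast
  next
    case False
    then obtain k where "k \<le> l" "z \<in> B k"
      using A_nbr[of j y z] assms z by blast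
    then show False
      using level_unique[of i k z] B_verts[of k] assms zi by blast
  qed
qed

lemma nontrivial_split:
  assumes "i \<le> l" "\<not> trivial_graph (C i)" "splitted_graph (C i) (A i) (B i)"
  shows "x \<in> B i \<Longrightarrow> \<exists>y\<in>A i. y \<in> nbrs G x"
    and "x \<in> B i \<Longrightarrow> \<exists>y\<in>A i. y \<notin> nbrs G x"
    and "y \<in> A i \<Longrightarrow> \<exists>x\<in>B i. x \<in> nbrs G y"
    and "y \<in> A i \<Longrightarrow> \<exists>x\<in>B i. x \<notin> nbrs G y"
  using indecomposable_splitted[OF assms(3) indecomposable[OF assms(1)] assms(2)]
    nbrs_same[OF assms(1)] A_verts[OF assms(1)] B_verts[OF assms(1)] by (meson subsetD)+

text \<open>Since a one-vertex core is placed in \<open>B 0\<close>, a one-vertex component with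
  nonempty independent set cannot be the core.\<close>

lemma trivial_comp:
  assumes "i \<le> l" "trivial_graph (C i)" "A i \<noteq> {}"
  shows "B i = {}" "0 < i" "\<exists>a. A i = {a} \<and> verts (C i) = {a}"
proof -
  obtain a where a: "verts (C i) = {a}"
    using assms(2) by (auto simp: trivial_graph_def card_1_singleton_iff)
  then have "A i = {a}"
    using A_verts[OF assms(1)] assms(3) by (simp add: subset_singleton_iff)
  then show "B i = {}" "\<exists>a. A i = {a} \<and> verts (C i) = {a}"
    using A_B_disjoint[OF assms(1)] B_verts[OF assms(1)] a by auto
  then show "0 < i"
    using trivial_core assms comp_nonempty[of 0] by (cases i) auto
qed

text \<open>Domination gives the weak inequality; strictness comes from a vertex adjacent to
  \<open>x\<close> but not to \<open>y\<close>. In general a vertex of \<open>A i\<close>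
  serves.\<close>

lemma strict_top_U:
  assumes i: "i \<le> l" and Ai: "A i \<noteq> {}"
  shows "strict_top_set G (U i)" "strict_top_set G (U (Suc i))"
proof -
  have spl: "splitted_graph (C i) (A i) (B i)"
    using A_nonempty_split i Ai by blast
  have level: "\<exists>j\<le>l. y \<in> verts (C j) \<and> (j < m \<or> y \<in> A j \<and> m \<le> j)"
    if "y \<in> verts G" "y \<notin> U m" "m = i \<or> m = Suc i" for y m
    using that(1,2)
  proof (cases rule: not_U_cases)
    case 3
    then show ?thesis using that Ai nonsplit_core by auto
  qed blast+
  show "strict_top_set G (U i)" "strict_top_set G (U (Suc i))"
  proof (atomize (full), cases "trivial_graph (C i)")
    case False
    note nt = nontrivial_split[OF i False spl]
    have 1: "degree G y < degree G b" if b: "b \<in> B i" and y: "y \<in> verts G" "y \<notin> U i" for b y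
    proof -
      obtain j where j: "j \<le> l" "y \<in> verts (C j)" "j < i \<or> y \<in> A j \<and> i \<le> j"
        using level[OF y] by blast
      note dom = nbrs_dominate[OF i b j]
      obtain z where z: "z \<in> A i" "z \<in> nbrs G b"
        using nt(1)[OF b] by blast
      show ?thesis
      proof (cases "z = y")
        case False
        then show ?thesis
          using degree_strict_mono[OF simple dom z(2)] comp_nonnbrs[OF i z(1) j(1,2)] j by blast
      next
        \<comment> \<open>Here the witness coincides with \<open>y\<close>, so \<open>y\<close> is
          in \<open>A i\<close>; it is replaced by a clique vertex that \<open>y\<close>
          misses.\<close>
        case True
        then obtain b' where b': "b' \<in> B i" "b' \<notin> nbrs G y"
          using nt(4) z by blast
        then have "b' \<noteq> b" "b' \<noteq> y"
          using z True nbrs_sym[of b G y] A_B_disjoint[OF i] by blast+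
        then show ?thesis
          using degree_strict_mono[OF simple dom _ b'(2)] B_adjacent[OF i b i b'(1)] by blast
      qed
    qed
    \<comment> \<open>Vertices further out than level \<open>i\<close> are compared with
      \<open>y\<close> through some vertex of \<open>B i\<close>.\<close>
    have 2: "degree G y < degree G x" if x: "x \<in> U i" and y: "y \<in> verts G" "y \<notin> U i" for x y
    proof (cases "x \<in> B i")
      case True
      then show ?thesis using 1 y by blast
    next
      case False
      then have "x \<in> U (Suc i)" using x U_Suc[OF i] by blast
      moreover obtain b where b: "b \<in> B i"
        using nt(3) Ai by blast
      moreover have "b \<notin> U (Suc i)" "b \<in> verts G"
        using b U_Suc_disjoint[OF i] B_verts[OF i] comp_verts[OF i] by blast+
      ultimately have "degree G b \<le> degree G x"
        using top_U[of "Suc i"] by (simp add: top_set_def)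
      then show ?thesis using 1[OF b y] by simp
    qed
    have "degree G y < degree G x" if x: "x \<in> U (Suc i)" and y: "y \<in> verts G" "y \<notin> U (Suc i)" for x y
    proof (cases "y \<in> B i")
      case True
      obtain i' where i': "Suc i \<le> i'" "i' \<le> l" "x \<in> B i'"
        using x by (auto elim: U_E)
      \<comment> \<open>Everything in \<open>U (Suc i)\<close> is adjacent to all of
        \<open>A i\<close>, while a vertex of \<open>B i\<close> misses part of it.\<close>
      obtain z where z: "z \<in> A i" "z \<notin> nbrs G y"
        using nt(2)[OF True] by blast
      have "z \<in> nbrs G x" "z \<noteq> y"
        using nbrs_above(1)[of i' x i z] i' z A_verts[OF i] A_B_disjoint[OF i] True by auto
      moreover have "y \<in> verts (C i)" "i < i'"
        using True B_verts[OF i] i' by auto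
      ultimately show ?thesis
        using degree_strict_mono[OF simple nbrs_dominate, of i' x i y z] i i' z by blast
    next
      case False
      then show ?thesis using 2[of x y] x y U_Suc[OF i] by blast
    qed
    with 2 show "strict_top_set G (U i) \<and> strict_top_set G (U (Suc i))"
      using U_verts by (simp add: strict_top_set_def)
  next
    case True
    obtain a where a: "A i = {a}" "verts (C i) = {a}"
      using trivial_comp[OF i True Ai] by blast
    have B0: "B i = {}" "0 < i"
      using trivial_comp[OF i True Ai] by blast+
    have "degree G y < degree G x" if x: "x \<in> U (Suc i)" and y: "y \<in> verts G" "y \<notin> U (Suc i)" for x y
    proof -
      obtain i' where i': "Suc i \<le> i'" "i' \<le> l" "x \<in> B i'"
        using x by (auto elim: U_E)
      obtain j where j: "j \<le> l" "y \<in> verts (C j)" "j < Suc i \<or> y \<in> A j \<and> Suc i \<le> j"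
        using level[OF y] by blast
      have "\<exists>j\<le>l. y \<in> verts (C j) \<and> (j < i' \<or> y \<in> A j \<and> i' \<le> j)"
        using j i' by (meson le_trans not_le)
      then have dom: "nbrs G y - {x} \<subseteq> nbrs G x"
        using nbrs_dominate i' by blast
      show ?thesis
      proof (cases "y = a")
        case False
        then have "j \<noteq> i" using j a by auto
        then have "a \<notin> nbrs G y"
          using comp_nonnbrs[OF i _ j(1,2), of a] j(3) a by auto
        moreover have "a \<in> nbrs G x"
          using nbrs_above(1)[of i' x i a] i' a by auto
        ultimately show ?thesis
          using degree_strict_mono[OF simple dom] False by blast
      next
        \<comment> \<open>The only vertex of \<open>A i\<close> is now \<open>y\<close> itself; a
          core vertex, adjacent to \<open>x\<close> but not to \<open>a\<close>, takes over as the
          witness.\<close>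
        case True
        obtain c where c: "c \<in> verts (C 0)"
          using comp_nonempty[of 0] by blast
        have "c \<noteq> a"
          using c a level_unique[of 0 i c] i B0 by auto
        moreover have "c \<notin> nbrs G a"
          using nbrs_below[of i a 0 c] i a B0 c by auto
        moreover have "c \<in> nbrs G x"
          using nbrs_above(1)[of i' x 0 c] i' c by auto
        ultimately show ?thesis
          using degree_strict_mono[OF simple dom] True by blast
      qed
    qed
    then have "strict_top_set G (U (Suc i))"
      using U_verts by (simp add: strict_top_set_def)
    moreover have "U i = U (Suc i)"
      using U_Suc[OF i] B0 by simp
    ultimately show "strict_top_set G (U i) \<and> strict_top_set G (U (Suc i))"
      by simp
  qed
qed

text \<open>Vertices on levels below \<open>m\<close>, and those of a non-split core, see all of
  \<open>U m\<close>; independent vertices from level \<open>m\<close> on have no neighbours outside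
  it.\<close>

lemma tight_U: "tight G (U m)"
  unfolding tight_def clique_nbrs
proof (intro conjI ballI impI)
  show "u \<in> nbrs G x" if "u \<in> U m" "x \<in> U m" "u \<noteq> x" for u x
    using that B_adjacent by (metis U_E)
  show "U m \<subseteq> nbrs G u \<or> nbrs G u \<subseteq> U m" if u: "u \<in> verts G - U m" for u
  proof -
    have "u \<in> verts G" "u \<notin> U m" using u by auto
    then show ?thesis
    proof (cases rule: not_U_cases)
      case (1 j)
      then show ?thesis
        using nbrs_above(2) by (metis U_E order.strict_trans2 subsetI)
    next
      case (2 j)
      then show ?thesis
        using A_nbr[of j u] U_I by (meson order.trans subsetI)
    next
      case 3
      have "x \<in> nbrs G u" if x: "x \<in> U m" for x
      proof -
        obtain i where i: "i \<le> l" "x \<in> B i" using x by (auto elim: U_E)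
        then have "0 < i" using 3 nonsplit_core by (cases i) auto
        then show ?thesis using nbrs_above(2) i 3 by blast
      qed
      then show ?thesis by blast
    qed
  qed
qed (rule U_verts)

text \<open>A tight set that meets a component but leaves out a vertex with a neighbour outside the set
  would decompose that component.\<close>

lemma tight_Int_comp:
  assumes X: "tight G X" and i: "i \<le> l" and nt: "\<not> trivial_graph (C i)"
  shows "X \<inter> verts (C i) = {} \<or> X \<inter> verts (C i) = B i"
proof (cases "X \<inter> verts (C i) = {}")
  case False
  let ?V = "verts (C i)"
  have same: "y \<in> nbrs (C i) x \<longleftrightarrow> y \<in> nbrs G x" if "x \<in> ?V" "y \<in> ?V" for x y
    using nbrs_same[OF i that] by simp
  have V: "?V \<subseteq> verts G" using comp_verts[OF i] .
  have cl: "y \<in> nbrs G x" if "x \<in> X" "y \<in> X" "x \<noteq> y" for x y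
    using X that by (simp add: tight_def clique_nbrs)
  have out: "X \<subseteq> nbrs G u \<or> nbrs G u \<subseteq> X" if "u \<in> ?V" "u \<notin> X" for u
    using X that V by (auto simp: tight_def)
  \<comment> \<open>\<open>S\<close> is independent and has no edge to \<open>R\<close> because its
    neighbourhoods stay in \<open>X\<close>; by tightness \<open>R\<close> sees all of
    \<open>X\<close>. This is the pattern of \<open>decomposableI\<close>.\<close>
  define S where "S = {u \<in> ?V - X. nbrs G u \<subseteq> X}"
  define R where "R = {u \<in> ?V - X. \<not> nbrs G u \<subseteq> X}"
  have "R = {}"
  proof (rule ccontr)
    assume R: "R \<noteq> {}"
    have "decomposable (C i)"
    proof (rule decomposableI[OF comp_simple[OF i], where S=S and K="X \<inter> ?V" and R=R])
      show "y \<in> nbrs (C i) x" if "x \<in> X \<inter> ?V" "y \<in> R" for x y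
      proof -
        have "x \<in> nbrs G y" using that out[of y] by (auto simp: R_def)
        then show ?thesis using same[of x y] that by (auto simp: R_def nbrs_sym[of x])
      qed
      show "y \<notin> nbrs (C i) x" if "x \<in> S" "y \<in> R" for x y
        using same[of x y] that by (auto simp: S_def R_def)
      show "y \<notin> nbrs (C i) x" if "x \<in> S" "y \<in> S" for x y
        using same[of x y] that by (auto simp: S_def)
      show "y \<in> nbrs (C i) x" if "x \<in> X \<inter> ?V" "y \<in> X \<inter> ?V" "x \<noteq> y" for x y
        using same[of x y] cl[of x y] that by simp
    qed (use R False in \<open>auto simp: S_def R_def\<close>)
    then show False using indecomposable[OF i] by blast
  qed
  then have sub: "nbrs G u \<subseteq> X" if "u \<in> ?V" "u \<notin> X" for u
    using that by (auto simp: R_def)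
  have spl: "splitted_graph (C i) (A i) (B i)"
  proof (rule ccontr)
    assume "\<not> ?thesis"
    then have i0: "i = 0" and ns: "\<not> split_graph (C 0)"
      using split_cases[OF i] by auto
    \<comment> \<open>With \<open>R\<close> empty, \<open>X\<close> itself induces a split
      partition, so a non-split core is impossible.\<close>
    have "splitted_graph (C i) (?V - X) (?V \<inter> X)"
      unfolding splitted_graph_def independent_nbrs clique_nbrs
      using comp_simple[OF i] same sub cl by (simp; blast)
    then show False using i0 ns by (auto simp: split_graph_def)
  qed
  note nt = nontrivial_split[OF i nt spl]
  have BX: "B i \<subseteq> X"
  proof
    fix b assume b: "b \<in> B i"
    show "b \<in> X"
    proof (rule ccontr)
      \<comment> \<open>All neighbours of \<open>b\<close> lie in the clique \<open>X\<close>, among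
        them an \<open>a\<close> in \<open>A i\<close> and a \<open>b'\<close> in \<open>B i\<close>
        that are not adjacent.\<close>
      assume bX: "b \<notin> X"
      then have N: "nbrs G b \<subseteq> X" using sub b B_verts[OF i] by blast
      obtain a where a: "a \<in> A i" "a \<in> nbrs G b" using nt(1)[OF b] by blast
      obtain b' where b': "b' \<in> B i" "b' \<notin> nbrs G a" using nt(4)[OF a(1)] by blast
      have "b' \<noteq> b" using a b' nbrs_sym[of a G b] by blast
      then have "b' \<in> X" using B_adjacent[OF i b i b'(1)] N by blast
      moreover have "a \<in> X" "a \<noteq> b'" using a N b' A_B_disjoint[OF i] by blast+
      ultimately show False using cl b' by blast
    qed
  qed
  have "x \<in> B i" if x: "x \<in> X \<inter> ?V" for x
  proof (rule ccontr)
    assume "x \<notin> B i"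
    then have xA: "x \<in> A i" using x spl by (auto simp: splitted_graph_def)
    obtain b where b: "b \<in> B i" "b \<notin> nbrs G x" using nt(4)[OF xA] by blast
    then show False using cl[of x b] x BX xA A_B_disjoint[OF i] by blast
  qed
  then show ?thesis using BX B_verts[OF i] by blast
qed simp

section \<open>Degrees measured against the sizes of the unions \<open>U\<close>\<close>

lemma core_adjacent_U: "c \<in> verts (C 0) \<Longrightarrow> U 1 \<subseteq> nbrs G c"
  using nbrs_above(2)[of _ _ 0 c] by (auto elim!: U_E)

lemma A_nbrs_subset: "i \<le> l \<Longrightarrow> a \<in> A i \<Longrightarrow> nbrs G a \<subseteq> U i"
  using A_nbr U_I by blast

lemma U_subset_A_nbrs: "i \<le> l \<Longrightarrow> a \<in> A i \<Longrightarrow> U (Suc i) \<subseteq> nbrs G a"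
  using nbrs_above(2)[of _ _ i a] A_verts[of i] by (auto elim!: U_E)

lemma degree_A_bounds:
  assumes i: "i \<le> l" and a: "a \<in> A i"
  shows "card (U (Suc i)) \<le> degree G a" "degree G a \<le> card (U i)"
  unfolding degree_nbrs
  using card_mono[OF finite_nbrs[OF simple] U_subset_A_nbrs[OF i a]]
    card_mono[OF finite_U A_nbrs_subset[OF i a]] .

lemma degree_A_strict:
  assumes i: "i \<le> l" and a: "a \<in> A i" and nt: "\<not> trivial_graph (C i)"
  shows "card (U (Suc i)) < degree G a" "degree G a < card (U i)"
proof -
  have spl: "splitted_graph (C i) (A i) (B i)" using A_nonempty_split i a by blast
  obtain b where b: "b \<in> B i" "b \<in> nbrs G a" using nontrivial_split(3)[OF i nt spl a] by blast
  obtain b' where b': "b' \<in> B i" "b' \<notin> nbrs G a" using nontrivial_split(4)[OF i nt spl a] by blast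
  have "U (Suc i) \<subset> nbrs G a"
    using U_subset_A_nbrs[OF i a] b U_Suc_disjoint[OF i] by blast
  then show "card (U (Suc i)) < degree G a"
    unfolding degree_nbrs by (rule psubset_card_mono[OF finite_nbrs[OF simple]])
  have "nbrs G a \<subset> U i"
    using A_nbrs_subset[OF i a] b' U_I[of b' i i] i by blast
  then show "degree G a < card (U i)"
    unfolding degree_nbrs by (rule psubset_card_mono[OF finite_U])
qed

text \<open>Besides \<open>U 0 - {b}\<close>, \<open>b\<close> sees a vertex of \<open>A i\<close>,
  which makes up for \<open>b\<close> itself.\<close>

lemma degree_B_ge:
  assumes i: "i \<le> l" and b: "b \<in> B i" and nt: "\<not> trivial_graph (C i)"
  shows "card (U 0) \<le> degree G b"
proof -
  have spl: "splitted_graph (C i) (A i) (B i)" using B_nonempty_split i b by blast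
  obtain a where a: "a \<in> A i" "a \<in> nbrs G b" using nontrivial_split(1)[OF i nt spl b] by blast
  have "insert a (U 0 - {b}) \<subseteq> nbrs G b"
    using a B_adjacent[OF i b] by (auto elim!: U_E)
  then have "card (insert a (U 0 - {b})) \<le> degree G b"
    unfolding degree_nbrs by (rule card_mono[OF finite_nbrs[OF simple]])
  moreover have "b \<in> U 0" "a \<notin> U 0"
    using b U_I i A_U_disjoint[OF i a(1)] by auto
  ultimately show ?thesis
    using finite_U by (simp add: card.insert_remove)
qed

lemma degree_core_ge:
  assumes "c \<in> verts (C 0)"
  shows "card (U 1) \<le> degree G c"
  unfolding degree_nbrs by (rule card_mono[OF finite_nbrs[OF simple] core_adjacent_U[OF assms]])

lemma degree_U_ge:
  assumes "x \<in> U 0"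
  shows "card (U 1) \<le> degree G x"
proof (cases "x \<in> U 1")
  case True
  obtain c where c: "c \<in> verts (C 0)"
    using comp_nonempty[of 0] by blast
  have "c \<in> verts G" "c \<notin> U 1"
    using c comp_verts[of 0] U_level[of c 1 0] by auto
  then have "degree G c \<le> degree G x"
    using top_U[of 1] True by (simp add: top_set_def)
  then show ?thesis using degree_core_ge[OF c] by simp
next
  case False
  then have "x \<in> B 0" using assms U_Suc[of 0] by auto
  then show ?thesis using degree_core_ge[of x] B_verts[of 0] by blast
qed

lemma degree_core_strict:
  assumes c: "c \<in> verts (C 0)" and nt: "\<not> trivial_graph (C 0)"
  shows "card (U 1) < degree G c"
proof -
  obtain y where y: "y \<in> nbrs (C 0) c"
    using indecomposable_ex_nbr[OF comp_simple indecomposable nt c] by auto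
  then have "y \<in> verts (C 0)"
    using nbrs_verts[OF comp_simple] by blast
  then have "y \<in> nbrs G c" "y \<notin> U 1"
    using y nbrs_same[of 0 c y] c U_level[of y 1 0] by auto
  then have "U 1 \<subset> nbrs G c"
    using core_adjacent_U[OF c] by blast
  then show ?thesis
    unfolding degree_nbrs by (rule psubset_card_mono[OF finite_nbrs[OF simple]])
qed

lemma degree_A:
  assumes i: "i \<le> l" and a: "a \<in> A i"
  shows "degree G a = degree (C i) a + card (U (Suc i))"
proof -
  have ai: "a \<in> verts (C i)" using a A_verts[OF i] by blast
  have "nbrs G a = nbrs (C i) a \<union> U (Suc i)"
  proof
    show "nbrs G a \<subseteq> nbrs (C i) a \<union> U (Suc i)"
      using A_nbrs_subset[OF i a] U_Suc[OF i] B_verts[OF i] nbrs_same[OF i ai] by blast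
    show "nbrs (C i) a \<union> U (Suc i) \<subseteq> nbrs G a"
      using U_subset_A_nbrs[OF i a] nbrs_same[OF i ai] nbrs_subset[OF comp_simple[OF i]] by blast
  qed
  moreover have "nbrs (C i) a \<inter> U (Suc i) = {}"
    using nbrs_subset[OF comp_simple[OF i], of a] U_level[of _ "Suc i" i] i by fastforce
  ultimately show ?thesis
    unfolding degree_nbrs using finite_U finite_nbrs[OF comp_simple[OF i]]
    by (simp add: card_Un_disjoint)
qed

text \<open>The neighbourhood splits by level: outer levels contribute their cliques, the own level
  the degree in the component, inner levels all their vertices.\<close>

lemma degree_B:
  assumes i: "i \<le> l" and b: "b \<in> B i"
  shows "degree G b = degree (C i) b + card (U (Suc i)) + card (\<Union>j<i. verts (C j))"
proof -
  let ?L = "\<Union>j<i. verts (C j)"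
  have bi: "b \<in> verts (C i)" using b B_verts[OF i] by blast
  have "y \<in> nbrs G b \<longleftrightarrow> y \<in> nbrs (C i) b \<or> y \<in> U (Suc i) \<or> y \<in> ?L" for y
  proof (cases "y \<in> verts G")
    case True
    then obtain j where j: "j \<le> l" "y \<in> verts (C j)" using verts_G by blast
    have N: "y \<in> nbrs (C i) b \<Longrightarrow> j = i"
      using nbrs_verts[OF comp_simple[OF i]] level_unique[OF j(1) i j(2)] by blast
    have L: "j < i" if y: "y \<in> ?L"
    proof -
      obtain k where "k < i" "y \<in> verts (C k)" using y by blast
      then show ?thesis using level_unique[of j k y] j i by simp
    qed
    show ?thesis
    proof (cases i j rule: linorder_cases)
      case less
      then have "y \<in> nbrs G b \<longleftrightarrow> y \<in> B j"
        using nbrs_below[of j y i b] j bi nbrs_sym[of y G b] by blast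
      also have "\<dots> \<longleftrightarrow> y \<in> U (Suc i)"
        using U_level[of y "Suc i" j] U_I[of y j "Suc i"] j less by auto
      finally show ?thesis using N L less by auto
    next
      case equal
      then show ?thesis
        using nbrs_same[OF i bi] j L U_level[of y "Suc i" j] by auto
    next
      case greater
      then show ?thesis
        using nbrs_above(1)[OF i b] j by blast
    qed
  next
    case False
    have "y \<notin> nbrs G b" "y \<notin> nbrs (C i) b" "y \<notin> U (Suc i)"
      using False nbrs_subset[OF simple, of b] nbrs_subset[OF comp_simple[OF i], of b]
        comp_verts[OF i] U_verts[of "Suc i"] by blast+
    moreover have "y \<notin> ?L"
      using False verts_G[of y] i by auto
    ultimately show ?thesis by blast
  qed
  then have "nbrs G b = nbrs (C i) b \<union> U (Suc i) \<union> ?L"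
    by (intro set_eqI) simp
  moreover have "nbrs (C i) b \<inter> U (Suc i) = {}"
    using nbrs_subset[OF comp_simple[OF i], of b] U_level[of _ "Suc i" i] i by fastforce
  moreover have "(nbrs (C i) b \<union> U (Suc i)) \<inter> ?L = {}"
  proof -
    have False if "y \<in> nbrs (C i) b \<or> y \<in> U (Suc i)" "j < i" "y \<in> verts (C j)" for y j
      using that nbrs_verts[OF comp_simple[OF i], of y b] level_unique[of i j y]
        U_level[of y "Suc i" j] i by auto
    then show ?thesis by blast
  qed
  moreover have "finite ?L"
    using i comp_simple by (auto intro!: finite_verts)
  ultimately show ?thesis
    unfolding degree_nbrs using finite_U finite_nbrs[OF comp_simple[OF i]]
    by (simp add: card_Un_disjoint)
qed

end

subsection \<open>Equality indices and the canonical decomposition\<close>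

locale indexed_layered_graph = indexed_graph G n d v + layered_graph G l C A B
  for G :: "'a graph" and n d v l C A B +
  assumes ties: "\<And>p q i. trivial_graph (C 0) \<Longrightarrow> p \<in> {1..n} \<Longrightarrow> q \<in> {1..n} \<Longrightarrow> v p \<in> verts (C 0) \<Longrightarrow>
      d q = d p \<Longrightarrow> 1 \<le> i \<Longrightarrow> i \<le> l \<Longrightarrow> (v q \<in> B i \<longrightarrow> q < p) \<and> (v q \<in> A i \<longrightarrow> p < q)"
begin

lemma card_U_le: "card (U m) \<le> n"
  using card_mono[OF finite_verts[OF graph] U_verts] bij_betw_same_card[OF index] by simp

text \<open>The size of \<open>U 1\<close> separates the two degrees weakly. A tie forces a
  one-vertex core, and then the convention on ties decides.\<close>

lemma core_listed_before_A:
  assumes q: "q \<in> {1..n}" "v q \<in> A i" "1 \<le> i" "i \<le> l" and p: "p \<in> {1..n}" "v p \<in> verts (C 0)"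
  shows "p < q"
proof -
  have le: "degree G (v q) \<le> card (U 1)" "card (U 1) \<le> degree G (v p)"
    using degree_A_bounds(2)[OF q(4,2)] card_U_mono[OF q(3)] degree_core_ge[OF p(2)] by simp_all
  show ?thesis
  proof (cases "degree G (v q) < degree G (v p)")
    case True
    then show ?thesis using degree_less_index q p by blast
  next
    case False
    then have "degree G (v q) = degree G (v p)" "trivial_graph (C 0)"
      using le degree_core_strict[OF p(2)] by force+
    then show ?thesis using ties[of p q i] q p degrees by simp
  qed
qed

text \<open>Nontrivial components are settled by \<open>tight_Int_comp\<close>. If \<open>x\<close>
  were the vertex of a one-vertex independent set, a core vertex would be listed before it, hence
  belong to the same clique \<open>first k\<close>, although the two are not adjacent.\<close>

lemma first_subset_U:
  assumes k: "k \<in> set (EG n d)"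
  shows "first k \<subseteq> U 0"
proof
  fix x assume x: "x \<in> first k"
  have kn: "k \<le> n" using k by (simp add: EG_iff)
  have tight: "tight G (first k)" using tight_first[OF k] .
  have xG: "x \<in> verts G" using x first_subset[OF kn] by blast
  show "x \<in> U 0"
  proof (rule ccontr)
    assume "x \<notin> U 0"
    with xG show False
    proof (cases rule: not_U_cases)
      case (2 j)
      show False
      proof (cases "trivial_graph (C j)")
        case False
        then show False
          using tight_Int_comp[OF tight 2(1) False] 2 x A_B_disjoint by blast
      next
        case True
        have j: "0 < j" using trivial_comp[OF 2(1) True] 2 by blast
        obtain q where q: "q \<in> {1..n}" "x = v q" using verts_v[OF xG] by blast
        obtain c where c: "c \<in> verts (C 0)" using comp_nonempty[of 0] by blast
        obtain p where p: "p \<in> {1..n}" "c = v p" using verts_v comp_verts[of 0] c by blast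
        have "p < q"
          using core_listed_before_A[of q j p] q p c j 2 by simp
        then have "c \<in> first k"
          using x q p v_in_first kn by (metis less_imp_le order.trans)
        moreover have "c \<noteq> x"
          using c level_unique[of 0 j c] 2 j by auto
        ultimately have "c \<in> nbrs G x"
          using tight x by (auto simp: tight_def clique_nbrs)
        then obtain j' where j': "j \<le> j'" "j' \<le> l" "c \<in> B j'"
          using A_nbr 2 by blast
        then have "j' = 0"
          using level_unique[of 0 j' c] c B_verts[of j'] by auto
        then show False using j j' by simp
      qed
    next
      case 3
      then have "\<not> trivial_graph (C 0)"
        using trivial_split comp_simple by blast
      then show False
        using tight_Int_comp[OF tight, of 0] 3 x nonsplit_core by auto
    qed simp
  qed
qed

section \<open>Initial segments at equality indices compared with the unions
  \<open>U\<close>\<close>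

lemma nontrivial_A_nonempty:
  "i \<le> l \<Longrightarrow> B i \<noteq> {} \<Longrightarrow> \<not> trivial_graph (C i) \<Longrightarrow> A i \<noteq> {}"
  using nontrivial_split(1)[OF _ _ B_nonempty_split] by blast

text \<open>A vertex of \<open>A i\<close> has both a neighbour and a nonneighbour in
  \<open>B i\<close>. Together with \<open>trivial_card_B\<close> this lets the size of a nonempty
  clique decide whether its component is trivial.\<close>

lemma nontrivial_card_B:
  assumes "i \<le> l" "B i \<noteq> {}" "\<not> trivial_graph (C i)"
  shows "2 \<le> card (B i)"
proof -
  note nt = nontrivial_split[OF assms(1,3) B_nonempty_split[OF assms(1,2)]]
  obtain a where a: "a \<in> A i" using nontrivial_A_nonempty[OF assms] by blast
  obtain b b' where b: "b \<in> B i" "b \<in> nbrs G a" "b' \<in> B i" "b' \<notin> nbrs G a"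
    using nt(3,4)[OF a] by blast
  then have "b \<noteq> b'" by blast
  then have "card {b, b'} = 2" by simp
  moreover have "finite (B i)"
    using finite_subset[OF B_verts finite_verts[OF comp_simple]] assms(1) by blast
  ultimately show ?thesis
    using card_mono[of "B i" "{b, b'}"] b by simp
qed

lemma trivial_card_B:
  assumes "i \<le> l" "B i \<noteq> {}" "trivial_graph (C i)"
  shows "card (B i) = 1" "A i = {}"
proof -
  obtain x where x: "verts (C i) = {x}"
    using assms(3) by (auto simp: trivial_graph_def card_1_singleton_iff)
  then show "card (B i) = 1"
    using B_verts[OF assms(1)] assms(2) by (simp add: subset_singleton_iff)
  show "A i = {}"
    using trivial_comp(1)[OF assms(1,3)] assms(2) by blast
qed

text \<open>No tie crosses the boundary of a strict top set, so it equals the initial segment of its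
  size.\<close>

lemma first_card_U:
  assumes "i \<le> l" "A i \<noteq> {}"
  shows "first (card (U i)) = U i" "first (card (U (Suc i))) = U (Suc i)"
proof -
  have "first (card S) = S" if S: "strict_top_set G S" "card S \<le> n" for S
  proof -
    have fin: "finite S" "finite (first (card S))"
      using S finite_subset[OF _ finite_verts[OF graph]] by (auto simp: strict_top_set_def first_def)
    have "S \<subseteq> first (card S) \<or> first (card S) \<subseteq> S"
      using strict_top_set_comparable[OF S(1) top_first[OF S(2)]] .
    then show ?thesis
      using card_subset_eq[OF fin(1), of "first (card S)"] card_subset_eq[OF fin(2), of S]
        card_first[OF S(2)] by auto
  qed
  then show "first (card (U i)) = U i" "first (card (U (Suc i))) = U (Suc i)"
    using strict_top_U[OF assms] card_U_le by blast+
qed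

text \<open>The sizes fall to \<open>card (U (Suc l)) = 0\<close>; the first one below
  \<open>k\<close> has a predecessor.\<close>

lemma card_U_between:
  assumes "0 < k" "k \<le> card (U 0)"
  shows "\<exists>m\<le>l. card (U (Suc m)) < k \<and> k \<le> card (U m)"
  using ex_least_nat_less[of "\<lambda>m. card (U m) < k" "Suc l"] assms U_last
  by (force simp: less_Suc_eq_le not_less)

lemma EG_iff_card_U: "k \<in> set (EG n d) \<longleftrightarrow> (\<exists>m\<le>Suc l. k = card (U m))"
proof
  assume "\<exists>m\<le>Suc l. k = card (U m)"
  then show "k \<in> set (EG n d)"
    using EG_equality_iff_tight[OF top_U] tight_U card_U_le by (auto simp: EG_iff)
next
  assume k: "k \<in> set (EG n d)"
  have kn: "k \<le> n" using k by (simp add: EG_iff)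
  have tight: "tight G (first k)" using tight_first[OF k] .
  have k0: "k \<le> card (U 0)"
    using card_mono[OF finite_U first_subset_U[OF k]] card_first[OF kn] by simp
  show "\<exists>m\<le>Suc l. k = card (U m)"
  proof (cases "k = 0")
    case True
    then show ?thesis using U_last by (metis card.empty order_refl)
  next
    case False
    then obtain m where m: "m \<le> l" "card (U (Suc m)) < k" "k \<le> card (U m)"
      using card_U_between k0 by blast
    have "k = card (U m)"
    proof (rule ccontr)
      assume ne: "k \<noteq> card (U m)"
      \<comment> \<open>A size strictly between two successive ones needs a gap of at least two,
        hence a nontrivial level with strict drops on both sides. These trap \<open>first k\<close>
        between \<open>U (Suc m)\<close> and \<open>U m\<close>, where tightness leaves only the two
        ends.\<close>
      then have B: "2 \<le> card (B m)" using card_U_Suc[OF m(1)] m by simp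
      then have Bne: "B m \<noteq> {}" by auto
      have nt: "\<not> trivial_graph (C m)" using trivial_card_B[OF m(1) Bne] B by auto
      note st = strict_top_U[OF m(1) nontrivial_A_nonempty[OF m(1) Bne nt]]
      have fin: "finite (first k)" by (simp add: first_def)
      have sub: "first k \<subseteq> U m"
        using strict_top_set_comparable[OF st(1) top_first[OF kn]] card_mono[OF fin, of "U m"]
          card_first[OF kn] ne m by auto
      have sup: "U (Suc m) \<subseteq> first k"
        using strict_top_set_comparable[OF st(2) top_first[OF kn]] card_mono[OF finite_U, of "first k" "Suc m"]
          card_first[OF kn] m by auto
      from tight_Int_comp[OF tight m(1) nt] show False
      proof
        assume "first k \<inter> verts (C m) = {}"
        then have "first k \<subseteq> U (Suc m)" using sub U_Suc[OF m(1)] B_verts[OF m(1)] by blast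
        then show False
          using card_mono[OF finite_U, of "first k" "Suc m"] card_first[OF kn] m by simp
      next
        assume "first k \<inter> verts (C m) = B m"
        then have "U m \<subseteq> first k" using sup U_Suc[OF m(1)] by blast
        then show False using card_mono[OF fin, of "U m"] card_first[OF kn] m ne by simp
      qed
    qed
    then show ?thesis using le_SucI[OF m(1)] by blast
  qed
qed

text \<open>Strictness can fail here, as the core of an edgeless graph may tie with other vertices.
  Instead, an initial segment at an equality index is contained in \<open>U 0\<close>, and the sizes
  agree.\<close>

lemma first_card_U_0: "first (card (U 0)) = U 0"
proof -
  have "card (U 0) \<in> set (EG n d)" using EG_iff_card_U by blast
  then show ?thesis
    using card_subset_eq[OF finite_U first_subset_U] card_first[OF card_U_le] by simp
qed

lemma consecutive_EG:
  "consecutive_terms (EG n d) k k' \<longleftrightarrow> k < k' \<and> k \<in> set (EG n d) \<and> k' \<in> set (EG n d) \<and>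
    (\<forall>z\<in>set (EG n d). \<not> (k < z \<and> z < k'))"
proof -
  have "consecutive_terms (EG n d) k k' \<longleftrightarrow> k < k' \<and> k' \<le> n \<and> EG_equality n d k \<and>
    EG_equality n d k' \<and> (\<forall>z. k < z \<and> z < k' \<longrightarrow> \<not> EG_equality n d z)"
    unfolding EG_def consecutive_filter by auto
  also have "\<dots> \<longleftrightarrow> k < k' \<and> k \<in> set (EG n d) \<and> k' \<in> set (EG n d) \<and>
    (\<forall>z\<in>set (EG n d). \<not> (k < z \<and> z < k'))"
    by (auto simp: EG_iff)
  finally show ?thesis .
qed

text \<open>Levels with empty clique repeat a size, so arbitrary representatives of \<open>k\<close>
  and \<open>k'\<close> need not be neighbours; \<open>m\<close> is chosen as the level where the
  size jumps up to \<open>k'\<close>.\<close>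

lemma consecutive_card_U:
  assumes c: "consecutive_terms (EG n d) k k'"
  shows "\<exists>m\<le>l. k = card (U (Suc m)) \<and> k' = card (U m)"
proof -
  have kk: "k < k'" and no: "\<And>z. z \<in> set (EG n d) \<Longrightarrow> k < z \<Longrightarrow> \<not> z < k'"
    using c by (auto simp: consecutive_EG)
  obtain a b where a: "k = card (U a)" and b: "k' = card (U b)"
    using c EG_iff_card_U by (auto simp: consecutive_EG)
  have "k' \<le> card (U 0)" using b card_U_mono by simp
  then obtain m where m: "m \<le> l" "card (U (Suc m)) < k'" "k' \<le> card (U m)"
    using card_U_between[of k'] kk by auto
  have "b \<le> m" using m(2) b card_U_mono[of "Suc m" b] by linarith
  then have k': "k' = card (U m)" using m(3) b card_U_mono[of b m] by simp
  have "m < a" using kk k' a card_U_mono[of a m] by linarith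
  then have "k \<le> card (U (Suc m))" using a card_U_mono[of "Suc m" a] by simp
  moreover have "card (U (Suc m)) \<in> set (EG n d)" using EG_iff_card_U m(1) by auto
  ultimately have "k = card (U (Suc m))" using no m(2) by (metis le_neq_implies_less)
  then show ?thesis using m(1) k' by blast
qed

text \<open>In a run of one-vertex cliques ties may permute the vertices, so \<open>j\<close> can
  differ from the level whose sizes are \<open>k\<close> and \<open>k'\<close>; the sizes are tied
  to \<open>j\<close> only for a nontrivial component.\<close>

lemma consecutive_diff:
  assumes c: "consecutive_terms (EG n d) k k'"
  shows "\<exists>j\<le>l. first k' - first k = B j \<and>
    (\<not> trivial_graph (C j) \<longrightarrow> k = card (U (Suc j)) \<and> k' = card (U j))"
proof -
  have kk: "k < k'" "k \<in> set (EG n d)" "k' \<in> set (EG n d)" and kn: "k' \<le> n"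
    using c by (auto simp: consecutive_EG EG_iff)
  obtain m where m: "m \<le> l" "k = card (U (Suc m))" "k' = card (U m)"
    using consecutive_card_U[OF c] by blast
  have cB: "card (B m) = k' - k" using card_U_Suc[OF m(1)] m by simp
  show ?thesis
  proof (cases "2 \<le> card (B m)")
    case True
    then have Bne: "B m \<noteq> {}" by auto
    then have nt: "\<not> trivial_graph (C m)" using trivial_card_B[OF m(1) Bne] True by auto
    have "first k' = U m" "first k = U (Suc m)"
      using first_card_U[OF m(1) nontrivial_A_nonempty[OF m(1) Bne nt]] m by simp_all
    then have "first k' - first k = B m"
      using U_Suc[OF m(1)] U_Suc_disjoint[OF m(1)] by blast
    then show ?thesis using m by blast
  next
    case False
    then have k': "k' = Suc k" using cB kk by simp
    have in1: "k' \<in> {1..n}" using k' kn by simp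
    have v1: "v k' \<in> first k'" "v k' \<notin> first k"
      using v_in_first[OF in1] kn kk(1) by auto
    have "first k' - first k = {v i |i. k < i \<and> i \<le> k'}"
      using first_diff kk(1) kn by simp
    also have "\<dots> = {v k'}"
      using k' by (auto simp: le_Suc_eq)
    finally have diff: "first k' - first k = {v k'}" .
    obtain j where j: "j \<le> l" "v k' \<in> B j"
      using first_subset_U[OF kk(3)] v1(1) by (auto elim: U_E)
    have ve: "v k' \<in> verts (C j)" using j B_verts by blast
    \<comment> \<open>Otherwise tightness of both initial segments would put all of
      \<open>B j\<close>, at least two vertices, into the one-element difference.\<close>
    have tr: "trivial_graph (C j)"
    proof (rule ccontr)
      assume nt: "\<not> ?thesis"
      have "first k' \<inter> verts (C j) = B j"
        using tight_Int_comp[OF tight_first[OF kk(3)] j(1) nt] v1 ve by blast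
      moreover have "first k \<inter> verts (C j) = {}"
        using tight_Int_comp[OF tight_first[OF kk(2)] j(1) nt] v1 ve j(2) by blast
      ultimately have "B j \<subseteq> {v k'}" using diff by blast
      then have "card (B j) \<le> 1" using card_mono[of "{v k'}" "B j"] by simp
      then show False using nontrivial_card_B[OF j(1) _ nt] j(2) by auto
    qed
    have "B j \<noteq> {}" using j(2) by blast
    then have "card (B j) = 1" using trivial_card_B(1)[OF j(1) _ tr] by blast
    then have "B j = {v k'}" using j(2) by (auto simp: card_1_singleton_iff)
    then show ?thesis using diff tr j(1) by metis
  qed
qed

lemma B_unique: "i \<le> l \<Longrightarrow> j \<le> l \<Longrightarrow> x \<in> B i \<Longrightarrow> x \<in> B j \<Longrightarrow> i = j"
  using level_unique B_verts by blast

lemma consecutive_B: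
  assumes c: "consecutive_terms (EG n d) k k'" and j: "j \<le> l" "B j = first k' - first k"
  shows "card (B j) = k' - k" "0 < k'" "v k' \<in> B j" "B j \<noteq> {}"
    "\<not> trivial_graph (C j) \<Longrightarrow> k = card (U (Suc j))" "\<not> trivial_graph (C j) \<Longrightarrow> k' = card (U j)"
proof -
  have kk: "k < k'" and kn: "k' \<le> n"
    using c by (auto simp: consecutive_EG EG_iff)
  have "first k \<subseteq> first k'" using first_mono kk by simp
  then show "card (B j) = k' - k"
    using card_first[of k] card_first[OF kn] kk kn j(2) by (simp add: card_Diff_subset first_def)
  show "0 < k'" using kk by simp
  then show v: "v k' \<in> B j"
    using v_in_first[of k'] kk kn j(2) by simp
  then show "B j \<noteq> {}" by blast
  obtain j' where j': "j' \<le> l" "first k' - first k = B j'"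
    "\<not> trivial_graph (C j') \<longrightarrow> k = card (U (Suc j')) \<and> k' = card (U j')"
    using consecutive_diff[OF c] by blast
  then have "j' = j" using B_unique[of j' j "v k'"] v j by simp
  then show "\<not> trivial_graph (C j) \<Longrightarrow> k = card (U (Suc j))" "\<not> trivial_graph (C j) \<Longrightarrow> k' = card (U j)"
    using j' by auto
qed

text \<open>Given a vertex \<open>b\<close> of \<open>B j\<close>, the pair consists of the least
  equality index whose initial segment contains \<open>b\<close> and the greatest one before it. The
  difference is a clique containing \<open>b\<close>, hence \<open>B j\<close>.\<close>

lemma B_iff_consecutive:
  assumes W: "W \<noteq> {}"
  shows "(\<exists>j\<le>l. W = B j) \<longleftrightarrow> (\<exists>k k'. consecutive_terms (EG n d) k k' \<and> W = first k' - first k)"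
proof
  assume "\<exists>k k'. consecutive_terms (EG n d) k k' \<and> W = first k' - first k"
  then show "\<exists>j\<le>l. W = B j" using consecutive_diff by metis
next
  assume "\<exists>j\<le>l. W = B j"
  then obtain j b where j: "j \<le> l" "W = B j" "b \<in> B j" using W by blast
  define Q where "Q k \<longleftrightarrow> k \<in> set (EG n d) \<and> b \<in> first k" for k
  have "b \<in> U 0" using U_I[OF j(3)] j(1) by simp
  then have "Q (card (U 0))"
    unfolding Q_def using first_card_U_0 EG_iff_card_U by auto
  define k' where "k' = (LEAST k. Q k)"
  have k': "Q k'" and least: "\<And>z. Q z \<Longrightarrow> k' \<le> z"
    unfolding k'_def using \<open>Q (card (U 0))\<close> by (auto intro: LeastI Least_le)
  have "0 < k'" using k' by (cases k') (auto simp: Q_def first_def)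
  define Z where "Z = {z \<in> set (EG n d). z < k'}"
  have "0 \<in> set (EG n d)" using EG_iff_card_U U_last by (metis card.empty order_refl)
  then have Z: "finite Z" "Z \<noteq> {}" using \<open>0 < k'\<close> by (auto simp: Z_def)
  define k where "k = Max Z"
  have k: "k \<in> Z" and mx: "\<And>z. z \<in> Z \<Longrightarrow> z \<le> k"
    unfolding k_def using Z by auto
  have "\<not> (k < z \<and> z < k')" if "z \<in> set (EG n d)" for z
    using mx[of z] that by (auto simp: Z_def)
  then have c: "consecutive_terms (EG n d) k k'"
    unfolding consecutive_EG using k k' by (auto simp: Z_def Q_def)
  have b: "b \<in> first k' - first k"
    using k' least[of k] k by (auto simp: Q_def Z_def)
  obtain j' where j': "j' \<le> l" "first k' - first k = B j'"
    using consecutive_diff[OF c] by blast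
  then have "j' = j" using B_unique[of j' j b] b j by simp
  then show "\<exists>k k'. consecutive_terms (EG n d) k k' \<and> W = first k' - first k"
    using c j' j by blast
qed

section \<open>Independent sets and \<open>dstar\<close> recovered from degrees\<close>

lemma degree_ge_card_U:
  assumes j: "j \<le> l" "B j \<noteq> {}" "\<not> trivial_graph (C j)" and x: "x \<in> U 0 \<or> x \<in> verts (C 0) - A 0"
  shows "card (U j) \<le> degree G x"
proof (cases "j = 0")
  case False
  then have "card (U j) \<le> card (U 1)" using card_U_mono[of 1 j] by simp
  then show ?thesis using degree_U_ge degree_core_ge x by (metis DiffD1 le_trans)
next
  case True
  \<comment> \<open>For \<open>j = 0\<close> the general bound \<open>card (U 1)\<close> is too
    weak; the core is split here, and its clique vertices reach \<open>card (U 0)\<close> by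
    \<open>degree_B_ge\<close>.\<close>
  have "splitted_graph (C 0) (A 0) (B 0)" using B_nonempty_split[of 0] j True by simp
  then have "x \<in> B 0 \<or> x \<in> U 1"
    using x U_Suc[of 0] by (auto simp: splitted_graph_def)
  then show ?thesis
  proof
    assume "x \<in> B 0"
    then show ?thesis using degree_B_ge[of 0 x] j True by simp
  next
    assume x: "x \<in> U 1"
    obtain b where b: "b \<in> B 0" using j True by blast
    have "strict_top_set G (U 1)"
      using strict_top_U(2)[of 0] nontrivial_A_nonempty[of 0] j True by simp
    moreover have "b \<in> verts G - U 1"
      using b U_Suc_disjoint[of 0] B_verts[of 0] comp_verts[of 0] by auto
    ultimately have "degree G b < degree G x"
      using x by (simp add: strict_top_set_def)
    then show ?thesis using degree_B_ge[of 0 b] b j True by simp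
  qed
qed

text \<open>For a trivial component both sides are empty, as \<open>k'\<close> is
  \<open>k + 1\<close>. Otherwise a degree below \<open>card (U j)\<close> excludes clique vertices
  and the core outside \<open>A 0\<close>, and the degree of an independent vertex locates its
  level.\<close>

lemma A_eq_degrees:
  assumes c: "consecutive_terms (EG n d) k k'" and j: "j \<le> l" "B j = first k' - first k"
  shows "A j = {x \<in> verts G. k < degree G x \<and> degree G x < k'}"
proof (cases "trivial_graph (C j)")
  case True
  note cons = consecutive_B[OF c j]
  have "A j = {}" "k' - k = 1"
    using trivial_card_B[OF j(1) cons(4) True] cons(1) by auto
  then show ?thesis by auto
next
  case False
  note cons = consecutive_B[OF c j]
  have k: "k = card (U (Suc j))" "k' = card (U j)" using cons(5,6) False by auto
  show ?thesis
  proof (intro equalityI subsetI)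
    fix x assume x: "x \<in> A j"
    then show "x \<in> {x \<in> verts G. k < degree G x \<and> degree G x < k'}"
      using degree_A_strict[OF j(1) x False] k A_verts[OF j(1)] comp_verts[OF j(1)] by auto
  next
    fix x assume "x \<in> {x \<in> verts G. k < degree G x \<and> degree G x < k'}"
    then have x: "x \<in> verts G" "card (U (Suc j)) < degree G x" "degree G x < card (U j)"
      using k by auto
    then have "\<not> (x \<in> U 0 \<or> x \<in> verts (C 0) - A 0)"
      using degree_ge_card_U[OF j(1) cons(4) False, of x] by auto
    then have nU: "x \<notin> U 0" "x \<notin> verts (C 0) - A 0" by auto
    from x(1) nU(1) show "x \<in> A j"
    proof (cases rule: not_U_cases)
      case (2 i)
      have "i = j"
      proof (cases i j rule: linorder_cases)
        case less
        then have "card (U j) \<le> card (U (Suc i))" using card_U_mono by simp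
        then show ?thesis using degree_A_bounds(1)[of i x] 2 x by simp
      next
        case greater
        then have "card (U i) \<le> card (U (Suc j))" using card_U_mono by simp
        then show ?thesis using degree_A_bounds(2)[of i x] 2 x by simp
      qed
      then show ?thesis using 2 by simp
    next
      case 3
      then show ?thesis using nU nonsplit_core by auto
    qed simp
  qed
qed

text \<open>In a nontrivial component an independent vertex has degree strictly between successive
  sizes. A clique vertex has degree at least \<open>card (U 0)\<close>, so equality would place it
  in \<open>first k\<close>; a vertex of a non-split core exceeds \<open>card (U 0)\<close>.\<close>

lemma trivial_if_degree_eq:
  assumes k: "k \<in> set (EG n d)" and i: "i \<in> {1..n}" "k < i" "degree G (v i) = k"
    and j: "j \<le> l" "v i \<in> verts (C j)"
  shows "trivial_graph (C j)"
proof (rule ccontr)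
  assume nt: "\<not> ?thesis"
  have kn: "k \<le> n" using k by (simp add: EG_iff)
  have out: "v i \<notin> first k" using v_in_first[OF i(1) kn] i(2) by simp
  have le: "k \<le> card (U 0)"
    using card_mono[OF finite_U first_subset_U[OF k]] card_first[OF kn] by simp
  obtain m where m: "k = card (U m)" using k EG_iff_card_U by blast
  consider "v i \<in> A j" | "v i \<in> B j" | "j = 0" "\<not> split_graph (C 0)"
    using comp_cases[OF j] by blast
  then show False
  proof cases
    case 1
    then show False
      using degree_A_strict[OF j(1) 1 nt] i(3) m card_U_mono[of m j] card_U_mono[of "Suc j" m]
      by (cases "m \<le> j") auto
  next
    case 2
    then have "k = card (U 0)" using degree_B_ge[OF j(1) 2 nt] i(3) le by simp
    moreover have "v i \<in> U 0" using U_I[OF 2] j by simp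
    ultimately show False using first_card_U_0 out by simp
  next
    case 3
    then have "U 0 = U 1" using U_Suc[of 0] nonsplit_core by simp
    then show False using degree_core_strict[of "v i"] 3 j nt i(3) le by simp
  qed
qed

lemma dstar_eq:
  assumes k: "k \<in> set (EG n d)" "0 < k" and j: "1 \<le> j" "j \<le> l" "v k \<in> verts (C j)"
  shows "dstar n d k = card (verts (C 0) \<union> (\<Union>i\<in>{1..l}. B i) \<union> (\<Union>i\<in>{1..j-1}. A i))"
proof -
  let ?S = "verts (C 0) \<union> (\<Union>i\<in>{1..l}. B i) \<union> (\<Union>i\<in>{1..j-1}. A i)"
  have kn: "k \<le> n" using k by (simp add: EG_iff)
  have kin: "k \<in> {1..n}" using k(2) kn by simp
  have vk: "v k \<in> first k" using v_in_first[OF kin kn] by simp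
  have vB: "v k \<in> B j"
    using first_subset_U[OF k(1)] vk U_level[of "v k" 0 j] j by blast
  \<comment> \<open>\<open>v k\<close> is the last vertex of \<open>first k\<close>, so its
    membership alone decides on which side of a strict drop the whole segment lies.\<close>
  have ub: "first k \<subseteq> S" if S: "strict_top_set G S" "v k \<in> S" for S
  proof (rule ccontr)
    assume "\<not> ?thesis"
    then obtain x where "x \<in> first k" "x \<notin> S" by blast
    then obtain p where p: "p \<in> {1..k}" "v p \<notin> S" by (auto simp: first_def)
    have "p \<in> {1..n}" using p(1) kn by simp
    then have "degree G (v p) < degree G (v k)"
      using S p v_verts by (simp add: strict_top_set_def)
    then show False using degree_less_index[of p k] p kin kn by simp
  qed
  have lb: "S \<subseteq> first k" if S: "strict_top_set G S" "v k \<notin> S" for S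
    using strict_top_set_comparable[OF S(1) top_first[OF kn]] S(2) vk by blast
  have kle: "k \<le> card T" if "first k \<subseteq> T" "finite T" for T
    using card_mono[OF that(2,1)] card_first[OF kn] by simp
  \<comment> \<open>This yields \<open>k \<le> card (U 1)\<close>, a lower bound for all core and
    clique degrees. The delicate case is a one-vertex core: a tie with \<open>v k\<close> would list
    the core vertex after \<open>v k\<close>.\<close>
  have "first k \<subseteq> U 1"
  proof (cases "A 0 = {}")
    case False
    then show ?thesis using ub strict_top_U(2)[of 0] U_I[OF vB] j by simp
  next
    case True
    show ?thesis
    proof
      fix x assume x: "x \<in> first k"
      show "x \<in> U 1"
      proof (rule ccontr)
        assume nx: "x \<notin> U 1"
        have "x \<in> U 0" using first_subset_U[OF k(1)] x by blast
        then have xB: "x \<in> B 0" using nx U_Suc[of 0] by auto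
        then have tr: "trivial_graph (C 0)" using nontrivial_A_nonempty[of 0] True by blast
        obtain p where p: "p \<in> {1..k}" "x = v p" using x by (auto simp: first_def)
        have pin: "p \<in> {1..n}" using p(1) kn by simp
        have "degree G (v p) \<le> degree G (v k)"
          using top_U[of 1] nx p U_I[OF vB, of 1] j v_verts[OF pin] by (simp add: top_set_def)
        then have "d k = d p"
          using degrees[OF pin] degrees[OF kin] descending[of p k] p(1) kn by simp
        then have "k < p"
          using ties[of p k j] tr pin kin p xB B_verts[of 0] vB j by auto
        then show False using p by simp
      qed
    qed
  qed
  then have k1: "k \<le> card (U 1)" using kle finite_U by blast
  have "{x \<in> verts G. k \<le> degree G x} = ?S"
  proof (intro equalityI subsetI)
    fix x assume "x \<in> {x \<in> verts G. k \<le> degree G x}"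
    then have x: "x \<in> verts G" "k \<le> degree G x" by auto
    show "x \<in> ?S"
    proof (cases "x \<in> U 0")
      case True
      then obtain i where "i \<le> l" "x \<in> B i" "x \<in> verts (C i)" by (auto elim: U_E)
      then show ?thesis by (cases i) auto
    next
      case False
      with x(1) show ?thesis
      proof (cases rule: not_U_cases)
        case (2 i)
        have "i < j"
        proof (rule ccontr)
          assume "\<not> ?thesis"
          then consider "j < i" | "i = j" by linarith
          then have "degree G x < k"
          proof cases
            case 1
            \<comment> \<open>\<open>U i\<close> misses \<open>v k\<close>, so it is a proper part
              of \<open>first k\<close>, and independent vertices at level \<open>i\<close> have
              degree below \<open>k\<close>.\<close>
            then have nU: "v k \<notin> U i" using U_level[of "v k" i j] j by auto
            have "strict_top_set G (U i)" using strict_top_U(1)[of i] 2 by blast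
            then have "U i \<subset> first k" using lb nU vk by blast
            then have "card (U i) < card (first k)"
              by (intro psubset_card_mono) (simp add: first_def)
            then show ?thesis using degree_A_bounds(2)[of i x] 2 card_first[OF kn] by simp
          next
            case eq: 2
            have Aj: "A j \<noteq> {}" using 2 eq by blast
            have nt: "\<not> trivial_graph (C j)" using trivial_comp(1)[OF j(2) _ Aj] vB by blast
            have "v k \<notin> U (Suc j)" using U_level[of "v k" "Suc j" j] j by auto
            then have "U (Suc j) \<subseteq> first k" using lb strict_top_U(2)[OF j(2) Aj] by blast
            moreover have "B j \<subseteq> first k"
              using tight_Int_comp[OF tight_first[OF k(1)] j(2) nt] vk j(3) by blast
            ultimately have "U j \<subseteq> first k" using U_Suc[OF j(2)] by blast
            then have "card (U j) \<le> k"
              using card_mono[of "first k" "U j"] card_first[OF kn] by (simp add: first_def)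
            then show ?thesis using degree_A_strict(2)[OF j(2) _ nt, of x] 2 eq by simp
          qed
          then show False using x by simp
        qed
        then show ?thesis using 2 by (cases "i = 0") auto
      qed auto
    qed
  next
    fix x assume "x \<in> ?S"
    then consider "x \<in> verts (C 0)" | i where "1 \<le> i" "i \<le> l" "x \<in> B i"
      | i where "1 \<le> i" "i < j" "x \<in> A i"
      by (fastforce simp: le_diff_conv)
    then show "x \<in> {x \<in> verts G. k \<le> degree G x}"
    proof cases
      case 1
      then show ?thesis using degree_core_ge[of x] k1 comp_verts[of 0] by auto
    next
      case (2 i)
      then have "x \<in> U 0" using U_I by blast
      then show ?thesis using degree_U_ge[of x] U_verts[of 0] k1 by auto
    next
      case (3 i)
      then have il: "i \<le> l" using j by simp
      have "strict_top_set G (U (Suc i))" using strict_top_U(2)[OF il] 3 by blast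
      then have "first k \<subseteq> U (Suc i)" using ub U_I[OF vB, of "Suc i"] 3 j by simp
      then have "k \<le> card (U (Suc i))" using kle finite_U by blast
      then show ?thesis
        using degree_A_bounds(1)[OF il 3(3)] 3 A_verts[OF il] comp_verts[OF il] by auto
    qed
  qed
  then show ?thesis by (simp add: dstar_card)
qed

text \<open>For \<open>j > 0\<close> the set in \<open>dstar_eq\<close> is regrouped by level; for
  \<open>j = 0\<close> the vertices of degree at least \<open>k'\<close> are exactly
  \<open>U 0\<close>. A one-vertex core has to be excluded: in an edgeless graph
  \<open>dstar n d 1\<close> is 0 but \<open>card (U 0)\<close> is 1.\<close>

lemma dstar_consecutive:
  assumes c: "consecutive_terms (EG n d) k k'" and j: "j \<le> l" "B j = first k' - first k"
    and nt: "j = 0 \<Longrightarrow> \<not> trivial_graph (C 0)"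
  shows "dstar n d k' = card (U j) + card (\<Union>i<j. verts (C i))"
proof (cases "j = 0")
  case True
  note cons = consecutive_B[OF c j]
  have k': "k' = card (U 0)" using cons(6) nt True by simp
  have "k < k'" using c by (simp add: consecutive_EG)
  then have "0 < card (B 0)" using cons(1) True by simp
  then have lt: "card (U 1) < card (U 0)" using card_U_Suc[of 0] by simp
  have "{x \<in> verts G. card (U 0) \<le> degree G x} = U 0"
  proof (intro equalityI subsetI)
    fix x assume "x \<in> {x \<in> verts G. card (U 0) \<le> degree G x}"
    then have x: "x \<in> verts G" "card (U 0) \<le> degree G x" by auto
    show "x \<in> U 0"
    proof (rule ccontr)
      assume "x \<notin> U 0"
      with x(1) show False
      proof (cases rule: not_U_cases)
        case (2 i)
        show False
        proof (cases "i = 0")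
          case True
          then show False using degree_A_strict(2)[of 0 x] 2 nt \<open>j = 0\<close> x by simp
        next
          case False
          then have "card (U i) \<le> card (U 1)" using card_U_mono[of 1 i] by simp
          then show False using degree_A_bounds(2)[of i x] 2 lt x by simp
        qed
      next
        case 3
        then show False using nonsplit_core cons(4) True by simp
      qed simp
    qed
  next
    fix x assume "x \<in> U 0"
    then show "x \<in> {x \<in> verts G. card (U 0) \<le> degree G x}"
      using degree_ge_card_U[OF j(1) cons(4), of x] nt True U_verts[of 0] by auto
  qed
  then show ?thesis using True k' by (simp add: dstar_card)
next
  case False
  note cons = consecutive_B[OF c j]
  let ?L = "\<Union>i<j. verts (C i)"
  have "k' \<in> set (EG n d)" using c by (simp add: consecutive_EG)
  moreover have "v k' \<in> verts (C j)" using cons(3) B_verts[OF j(1)] by blast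
  ultimately have "dstar n d k' =
    card (verts (C 0) \<union> (\<Union>i\<in>{1..l}. B i) \<union> (\<Union>i\<in>{1..j-1}. A i))"
    using dstar_eq[of k' j] cons(2) False j(1) by simp
  also have "verts (C 0) \<union> (\<Union>i\<in>{1..l}. B i) \<union> (\<Union>i\<in>{1..j-1}. A i) = U j \<union> ?L"
  proof (intro equalityI subsetI)
    fix x assume "x \<in> verts (C 0) \<union> (\<Union>i\<in>{1..l}. B i) \<union> (\<Union>i\<in>{1..j-1}. A i)"
    then consider "x \<in> verts (C 0)" | i where "1 \<le> i" "i \<le> l" "x \<in> B i"
      | i where "1 \<le> i" "i < j" "x \<in> A i"
      by (fastforce simp: le_diff_conv)
    then show "x \<in> U j \<union> ?L"
    proof cases
      case 1
      then show ?thesis using False by auto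
    next
      case (2 i)
      then show ?thesis using U_I[of x i j] B_verts[of i] by (cases "i < j") auto
    next
      case (3 i)
      then show ?thesis using A_verts[of i] j(1) by auto
    qed
  next
    fix x assume "x \<in> U j \<union> ?L"
    then show "x \<in> verts (C 0) \<union> (\<Union>i\<in>{1..l}. B i) \<union> (\<Union>i\<in>{1..j-1}. A i)"
    proof
      assume "x \<in> U j"
      then show ?thesis using False by (auto elim!: U_E)
    next
      assume "x \<in> ?L"
      then obtain i where i: "i < j" "x \<in> verts (C i)" by blast
      show ?thesis
      proof (cases "i = 0")
        case i0: False
        then have "x \<in> A i \<or> x \<in> B i" using comp_cases[of i x] i j(1) by auto
        moreover have "i \<in> {1..l}" "i \<in> {1..j-1}" using i i0 j(1) by auto
        ultimately show ?thesis by blast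
      qed (use i in simp)
    qed
  qed
  also have "card (U j \<union> ?L) = card (U j) + card ?L"
  proof (rule card_Un_disjoint[OF finite_U])
    show "finite ?L" using j(1) comp_simple by (auto intro!: finite_verts)
    have False if "x \<in> U j" "i < j" "x \<in> verts (C i)" for x i
      using U_level[OF that(1,3)] that j(1) by simp
    then show "U j \<inter> ?L = {}" by blast
  qed
  finally show ?thesis .
qed

end

text \<open>Permits resetting \<open>B 0\<close> for a non-split core while keeping the same
  composition.\<close>

lemma composition_cong: "(\<And>i. 1 \<le> i \<Longrightarrow> i \<le> m \<Longrightarrow> B i = B' i) \<Longrightarrow> composition C B m = composition C B' m"
  by (induction m) auto

theorem theorem5p6:
  fixes G :: "'a graph" and n l :: nat and d :: "nat \<Rightarrow> nat" and v :: "nat \<Rightarrow> 'a"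
    and C :: "nat \<Rightarrow> 'a graph" and A B :: "nat \<Rightarrow> 'a set"
  assumes graph: "simple_graph G"
    and index: "bij_betw v {1..n} (verts G)"
    and degrees: "\<And>i. i \<in> {1..n} \<Longrightarrow> degree G (v i) = d i"
    and descending: "\<And>i j. 1 \<le> i \<Longrightarrow> i \<le> j \<Longrightarrow> j \<le> n \<Longrightarrow> d j \<le> d i"
    and decomposition: "canonical_decomposition G l C A B"
    and core_split: "split_graph (C 0) \<Longrightarrow> splitted_graph (C 0) (A 0) (B 0)"
    and core_trivial: "trivial_graph (C 0) \<Longrightarrow> B 0 = verts (C 0)"
    and ties: "ties_respect_core n d v l C A B"
  shows
    \<comment> \<open>(a)\<close>
    "((\<forall>W. W \<subseteq> verts G \<and> W \<noteq> {} \<longrightarrow>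
        ((\<exists>j\<in>{0..l}. (j = 0 \<longrightarrow> split_graph (C 0)) \<and> W = B j) \<longleftrightarrow>
         (\<exists>k k'. consecutive_terms (EG n d) k k' \<and> W = {v i | i. k < i \<and> i \<le> k'})))
      \<and> (\<forall>j\<in>{0..l}. \<forall>k k'. (j = 0 \<longrightarrow> split_graph (C 0)) \<and>
           consecutive_terms (EG n d) k k' \<and> B j = {v i | i. k < i \<and> i \<le> k'} \<longrightarrow>
           A j = {x \<in> verts G. k < degree G x \<and> degree G x < k'}))
     \<and> \<comment> \<open>(b)\<close>
     (\<forall>k\<in>set (EG n d). \<forall>i\<in>{1..n}. k < i \<and> degree G (v i) = k \<longrightarrow>
        (\<forall>j\<in>{0..l}. v i \<in> verts (C j) \<longrightarrow> trivial_graph (C j)))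
     \<and> \<comment> \<open>(c)\<close>
     (\<forall>k\<in>set (EG n d). \<forall>j\<in>{1..l}. 0 < k \<and> v k \<in> verts (C j) \<longrightarrow>
        dstar n d k =
          card (verts (C 0) \<union> (\<Union>i\<in>{1..l}. B i) \<union> (\<Union>i\<in>{1..j-1}. A i)))
     \<and> \<comment> \<open>(d)\<close>
     (\<forall>j\<in>{0..l}. \<forall>k k'.
        (j = 0 \<longrightarrow> split_graph (C 0) \<and> \<not> trivial_graph (C 0)) \<and>
        consecutive_terms (EG n d) k k' \<and> B j = {v i | i. k < i \<and> i \<le> k'} \<longrightarrow>
        (\<forall>x\<in>B j. int (degree G x) =
           int (degree (C j) x) - int k' + int k + int (dstar n d k')) \<and>
        (\<forall>x\<in>A j. degree G x = degree (C j) x + k))"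
proof -
  \<comment> \<open>The given \<open>A 0\<close> and \<open>B 0\<close> are arbitrary when the core
    is not split; the empty sets bring this case into \<open>layered_graph\<close>.\<close>
  define A' where "A' = (if split_graph (C 0) then A else A(0 := {}))"
  define B' where "B' = (if split_graph (C 0) then B else B(0 := {}))"
  have same: "A' j = A j" "B' j = B j" if "j = 0 \<longrightarrow> split_graph (C 0)" for j
    using that by (auto simp: A'_def B'_def)
  have pos: "A' j = A j" "B' j = B j" if "1 \<le> j" for j
    using that by (auto simp: A'_def B'_def)
  have nonsplit: "A' 0 = {}" "B' 0 = {}" if "\<not> split_graph (C 0)"
    using that by (auto simp: A'_def B'_def)
  have comps: "\<And>i. i \<le> l \<Longrightarrow> simple_graph (C i) \<and> verts (C i) \<noteq> {} \<and> \<not> decomposable (C i)"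
    and splits: "\<And>i. 1 \<le> i \<Longrightarrow> i \<le> l \<Longrightarrow> splitted_graph (C i) (A i) (B i)"
    and disj: "\<And>i j. i \<le> l \<Longrightarrow> j \<le> l \<Longrightarrow> i \<noteq> j \<Longrightarrow> verts (C i) \<inter> verts (C j) = {}"
    and G: "G = composition C B l"
    using decomposition unfolding canonical_decomposition_def by auto
  interpret indexed_layered_graph G n d v l C A' B'
  proof unfold_locales
    show "G = composition C B' l"
      unfolding G by (rule composition_cong) (simp add: pos)
    show "splitted_graph (C 0) (A' 0) (B' 0) \<or> \<not> split_graph (C 0) \<and> A' 0 = {} \<and> B' 0 = {}"
      using core_split same[of 0] nonsplit by (cases "split_graph (C 0)") simp_all
    show "B' 0 = verts (C 0)" if "trivial_graph (C 0)"
      using trivial_split[OF _ that] comps[of 0] core_trivial[OF that] same(2)[of 0] by simp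
    show "(v q \<in> B' i \<longrightarrow> q < p) \<and> (v q \<in> A' i \<longrightarrow> p < q)"
      if "trivial_graph (C 0)" "p \<in> {1..n}" "q \<in> {1..n}" "v p \<in> verts (C 0)" "d q = d p" "1 \<le> i" "i \<le> l"
      for p q i
    proof -
      have "(v q \<in> (\<Union>j\<in>{1..l}. B j) \<longrightarrow> q < p) \<and> (v q \<in> (\<Union>j\<in>{1..l}. A j) \<longrightarrow> p < q)"
        using ties that(1-5) unfolding ties_respect_core_def by blast
      moreover have "i \<in> {1..l}" using that by simp
      ultimately show ?thesis
        using pos[OF that(6)] by blast
    qed
  qed (use graph index degrees descending comps splits disj pos in auto)
  have diff: "{v i | i. k < i \<and> i \<le> k'} = first k' - first k" if "consecutive_terms (EG n d) k k'" for k k'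
    using that first_diff[of k k'] by (auto simp: consecutive_EG EG_iff)
  have a: "(\<exists>j\<in>{0..l}. (j = 0 \<longrightarrow> split_graph (C 0)) \<and> W = B j) \<longleftrightarrow>
      (\<exists>k k'. consecutive_terms (EG n d) k k' \<and> W = {v i | i. k < i \<and> i \<le> k'})"
    if W: "W \<noteq> {}" for W
  proof -
    have "(\<exists>j\<in>{0..l}. (j = 0 \<longrightarrow> split_graph (C 0)) \<and> W = B j) \<longleftrightarrow> (\<exists>j\<le>l. W = B' j)"
    proof
      assume "\<exists>j\<le>l. W = B' j"
      then obtain j where j: "j \<le> l" "W = B' j" by blast
      have j0: "j = 0 \<longrightarrow> split_graph (C 0)" using j W nonsplit by auto
      moreover have "W = B j" using j(2) same(2)[OF j0] by simp
      ultimately show "\<exists>j\<in>{0..l}. (j = 0 \<longrightarrow> split_graph (C 0)) \<and> W = B j"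
        using j(1) by (intro bexI[of _ j]) simp_all
    next
      assume "\<exists>j\<in>{0..l}. (j = 0 \<longrightarrow> split_graph (C 0)) \<and> W = B j"
      then obtain j where "j \<le> l" "j = 0 \<longrightarrow> split_graph (C 0)" "W = B j" by auto
      then show "\<exists>j\<le>l. W = B' j" using same(2)[of j] by metis
    qed
    also have "\<dots> \<longleftrightarrow> (\<exists>k k'. consecutive_terms (EG n d) k k' \<and> W = {v i | i. k < i \<and> i \<le> k'})"
      unfolding B_iff_consecutive[OF W] by (intro ex_cong1 conj_cong refl) (simp add: diff)
    finally show ?thesis .
  qed
  have a': "A j = {x \<in> verts G. k < degree G x \<and> degree G x < k'}"
    if "j \<in> {0..l}" "j = 0 \<longrightarrow> split_graph (C 0)" "consecutive_terms (EG n d) k k'"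
      "B j = {v i | i. k < i \<and> i \<le> k'}" for j k k'
    using A_eq_degrees[of k k' j] that diff[of k k'] same[of j] by simp
  have c: "dstar n d k = card (verts (C 0) \<union> (\<Union>i\<in>{1..l}. B i) \<union> (\<Union>i\<in>{1..j-1}. A i))"
    if "k \<in> set (EG n d)" "j \<in> {1..l}" "0 < k" "v k \<in> verts (C j)" for k j
    using dstar_eq[of k j] that by (simp add: pos)
  have dd: "(\<forall>x\<in>B j. int (degree G x) = int (degree (C j) x) - int k' + int k + int (dstar n d k')) \<and>
      (\<forall>x\<in>A j. degree G x = degree (C j) x + k)"
    if j: "j \<in> {0..l}" "j = 0 \<longrightarrow> split_graph (C 0) \<and> \<not> trivial_graph (C 0)"
      and kk: "consecutive_terms (EG n d) k k'" and Bj: "B j = {v i | i. k < i \<and> i \<le> k'}" for j k k'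
  proof -
    have AB: "A' j = A j" "B' j = B j" using same j by auto
    have jl: "j \<le> l" and B': "B' j = first k' - first k"
      using j Bj diff[OF kk] AB by auto
    note cons = consecutive_B[OF kk jl B']
    have "k < k'" using kk by (simp add: consecutive_EG)
    \<comment> \<open>\<open>dstar_consecutive\<close> counts \<open>B j\<close>, whereas
      \<open>degree_B\<close> counts only the part of it that \<open>x\<close> sees inside
      \<open>C j\<close>; the correction \<open>k' - k\<close> is exactly its size.\<close>
    then have k: "int (card (B' j)) = int k' - int k" using cons(1) by simp
    have "int (degree G x) = int (degree (C j) x) - int k' + int k + int (dstar n d k')"
      if "x \<in> B j" for x
      using degree_B[OF jl, of x] dstar_consecutive[OF kk jl B'] card_U_Suc[OF jl] k that AB j(2) by simp
    moreover have "degree G x = degree (C j) x + k" if "x \<in> A j" for x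
    proof -
      \<comment> \<open>A trivial component with nonempty clique has an empty independent set;
        nontriviality then gives \<open>k = card (U (Suc j))\<close>.\<close>
      have "\<not> trivial_graph (C j)" using trivial_card_B(2)[OF jl cons(4)] that AB by auto
      then show ?thesis using degree_A[OF jl, of x] that AB cons(5) by simp
    qed
    ultimately show ?thesis by blast
  qed
  show ?thesis
  proof (intro conjI allI ballI impI; (elim conjE)?)
    fix W :: "'a set" assume "W \<noteq> {}"
    then show "(\<exists>j\<in>{0..l}. (j = 0 \<longrightarrow> split_graph (C 0)) \<and> W = B j) \<longleftrightarrow>
      (\<exists>k k'. consecutive_terms (EG n d) k k' \<and> W = {v i | i. k < i \<and> i \<le> k'})"
      by (rule a)
  next
    fix k i j assume "k \<in> set (EG n d)" "i \<in> {1..n}" "k < i" "degree G (v i) = k" "j \<in> {0..l}"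
      "v i \<in> verts (C j)"
    then show "trivial_graph (C j)" using trivial_if_degree_eq[of k i j] by simp
  next
    fix j k k' x assume "j \<in> {0..l}" "j = 0 \<longrightarrow> split_graph (C 0) \<and> \<not> trivial_graph (C 0)"
      "consecutive_terms (EG n d) k k'" "B j = {v i | i. k < i \<and> i \<le> k'}"
    note dd = dd[OF this]
    show "int (degree G x) = int (degree (C j) x) - int k' + int k + int (dstar n d k')" if "x \<in> B j"
      using dd that by blast
    show "degree G x = degree (C j) x + k" if "x \<in> A j"
      using dd that by blast
  qed (rule a' c; assumption)+
qed

end
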